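(* Let $I$ be an ideal in $R=\mathbb k[x_1,\dots,x_n,y]$ and let $\{y^{d_i}q_i+r_i\}_{i=1}^m$ be a Gröbner basis for $I$ with respect to $\prec$, where $y^{d_i}q_i$ is the initial $y$-form of $y^{d_i}q_i+r_i$ and $y$ does not divide $q_i$. Set $$I'=\langle y^{d_i}q_i\mid i=1,\dots,m\rangle,\qquad C=\langle q_i\mid i=1,\dots,m\rangle,\qquad P=\langle q_i\mid d_i=0\rangle+\langle y\rangle .$$ Then: (a) The given generating sets of $I'$, $C$ and $P$ are Gröbner bases, and $I'=\mathrm{in}_y I$. (b) If $\max_i d_i=1$, then $I'=C\cap P$ and $\mathrm{in}(C+P)=\mathrm{in}\,C+\mathrm{in}\,P$. (c) $\sqrt{I'}=\sqrt C\cap\sqrt P$. (d) $C=(I':y^\infty)$, where $(I':y^\infty)=\{f\in R\mid y^jf\in I'\text{ for some }j\ge0\}$. (e) If $I$ is homogeneous, then $h_{R/I}(s)\ge h_{R/P}(s)+s\cdot h_{R/C}(s)$, with equality if and only if $I'=C\cap P$.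
   Context: $\mathbb k$ is an arbitrary field. The initial $y$-form $\mathrm{in}_y p$ of $p\in R$ is the sum of all terms of $p$ having the highest power of $y$. $\prec$ is a fixed term order on $R$ such that $\mathrm{in}\,p=\mathrm{in}(\mathrm{in}_y p)$ for every $p\in R$, where $\mathrm{in}\,p$ is the initial term. For an ideal $J$, $\mathrm{in}\,J$ is the ideal generated by the initial terms of elements of $J$, and $\mathrm{in}_yJ$ is the ideal generated by the initial $y$-forms of elements of $J$. "Gröbner basis" is with respect to $\prec$. "Homogeneous" is with respect to the $\mathbb Z$-grading in which all variables have degree $1$; for homogeneous $J$, $h_{R/J}(s)=\sum_k\dim_{\mathbb k}(R/J)_k s^k$ is the Hilbert series, and $h\ge h'$ means coefficientwise inequality of power series. *)

theory Defs
  imports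
    "HOL-Library.Poly_Mapping"
    "HOL-Computational_Algebra.Formal_Power_Series"
    "HOL-Algebra.Ideal"
    "HOL-Algebra.QuotRing"
    "HOL-Algebra.Embedded_Algebras"
    "HOL-Algebra.Algebraic_Closure_Type"
begin

text \<open>
  Monomials are exponent vectors (multiplication of monomials is addition of exponents), and
  polynomials are finitely supported coefficient functions on monomials with the convolution
  product. The finite type \<open>'v\<close> is the whole set of variables. Distinguishing one element
  \<open>y\<close> of \<open>'v\<close> gives the ring $k[x_1,\dots,x_n,y]$, where $n \ge 0$ is the number of
  the other elements.
\<close>

type_synonym 'v monomial = "'v \<Rightarrow>\<^sub>0 nat"
type_synonym ('v, 'k) mpoly = "'v monomial \<Rightarrow>\<^sub>0 'k"

abbreviation poly_ring :: "('v, 'k::field) mpoly ring"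
  where "poly_ring \<equiv> ring_of_type_algebra"

definition var :: "'v \<Rightarrow> ('v, 'k::field) mpoly"
  where "var v = Poly_Mapping.single (Poly_Mapping.single v 1) 1"

definition const :: "'k::field \<Rightarrow> ('v, 'k) mpoly"
  where "const c = Poly_Mapping.single 0 c"


section \<open>Term orders, initial terms and initial forms\<close>

text \<open>The argument is the strict order.\<close>

definition term_order :: "('v monomial \<Rightarrow> 'v monomial \<Rightarrow> bool) \<Rightarrow> bool"
  where "term_order prec \<longleftrightarrow>
    irreflp prec \<and> transp prec \<and> totalp prec \<and>
    (\<forall>s t u. prec s t \<longrightarrow> prec (s + u) (t + u)) \<and>
    (\<forall>t. t \<noteq> 0 \<longrightarrow> prec 0 t)"

text \<open>The initial term carries its coefficient; the initial term of \<open>0\<close> is \<open>0\<close>.\<close>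

definition init_term ::
    "('v monomial \<Rightarrow> 'v monomial \<Rightarrow> bool) \<Rightarrow> ('v, 'k::field) mpoly \<Rightarrow> ('v, 'k) mpoly"
  where "init_term prec p =
    (if p = 0 then 0
     else let t = (THE t. t \<in> Poly_Mapping.keys p \<and>
                     (\<forall>s\<in>Poly_Mapping.keys p. s \<noteq> t \<longrightarrow> prec s t))
          in Poly_Mapping.single t (Poly_Mapping.lookup p t))"

definition init_form :: "'v \<Rightarrow> ('v, 'k::field) mpoly \<Rightarrow> ('v, 'k) mpoly"
  where "init_form y p =
    (\<Sum>t \<in> {t \<in> Poly_Mapping.keys p.
              \<forall>s\<in>Poly_Mapping.keys p. Poly_Mapping.lookup s y \<le> Poly_Mapping.lookup t y}.
       Poly_Mapping.single t (Poly_Mapping.lookup p t))"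

definition init_ideal ::
    "('v monomial \<Rightarrow> 'v monomial \<Rightarrow> bool) \<Rightarrow> ('v, 'k::field) mpoly set \<Rightarrow> ('v, 'k) mpoly set"
  where "init_ideal prec J = Idl\<^bsub>poly_ring\<^esub> (init_term prec ` J)"

definition init_form_ideal :: "'v \<Rightarrow> ('v, 'k::field) mpoly set \<Rightarrow> ('v, 'k) mpoly set"
  where "init_form_ideal y J = Idl\<^bsub>poly_ring\<^esub> (init_form y ` J)"

definition groebner_basis ::
    "('v monomial \<Rightarrow> 'v monomial \<Rightarrow> bool) \<Rightarrow> ('v, 'k::field) mpoly set \<Rightarrow> ('v, 'k) mpoly set \<Rightarrow> bool"
  where "groebner_basis prec G J \<longleftrightarrow>
    finite G \<and> G \<subseteq> J \<and> init_ideal prec J = Idl\<^bsub>poly_ring\<^esub> (init_term prec ` G)"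


section \<open>Radicals and saturation\<close>

definition ideal_radical :: "('v, 'k::field) mpoly set \<Rightarrow> ('v, 'k) mpoly set"
  where "ideal_radical J = {f. \<exists>k\<ge>1. f ^ k \<in> J}"

definition saturation :: "('v, 'k::field) mpoly set \<Rightarrow> ('v, 'k) mpoly \<Rightarrow> ('v, 'k) mpoly set"
  where "saturation J g = {f. \<exists>j::nat. g ^ j * f \<in> J}"


section \<open>Standard grading and Hilbert series\<close>

definition mono_degree :: "'v::finite monomial \<Rightarrow> nat"
  where "mono_degree t = (\<Sum>v\<in>UNIV. Poly_Mapping.lookup t v)"

definition hom_piece :: "nat \<Rightarrow> ('v::finite, 'k::field) mpoly set"
  where "hom_piece k = {p. \<forall>t\<in>Poly_Mapping.keys p. mono_degree t = k}"

definition homogeneous_ideal :: "('v::finite, 'k::field) mpoly set \<Rightarrow> bool"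
  where "homogeneous_ideal J \<longleftrightarrow>
    (\<exists>S. S \<subseteq> (\<Union>k. hom_piece k) \<and> J = Idl\<^bsub>poly_ring\<^esub> S)"

text \<open>
  The graded piece $(R/J)_k$ is the image of $R_k$ in the quotient ring \<open>poly_ring Quot J\<close>.
  The library measures dimensions over a subfield of the ring, so the scalars are the residue
  classes of the constants. For proper \<open>J\<close> these form a copy of the ground field; for the
  unit ideal the quotient ring is zero and every dimension is \<open>0\<close>, as it should be.
\<close>

definition quot_scalars :: "('v, 'k::field) mpoly set \<Rightarrow> ('v, 'k) mpoly set set"
  where "quot_scalars J = range (\<lambda>c. J +>\<^bsub>poly_ring\<^esub> const c)"

definition quot_piece :: "('v::finite, 'k::field) mpoly set \<Rightarrow> nat \<Rightarrow> ('v, 'k) mpoly set set"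
  where "quot_piece J k = (\<lambda>p. J +>\<^bsub>poly_ring\<^esub> p) ` hom_piece k"

definition hilbert_series :: "('v::finite, 'k::field) mpoly set \<Rightarrow> int fps"
  where "hilbert_series J =
    Abs_fps (\<lambda>k. int (ring.dim (poly_ring Quot J) (quot_scalars J) (quot_piece J k)))"

end

theory Submission
  imports Defs
begin

text \<open>
  The elements $q_i$ do not involve $y$, and everything is read off from leading monomials. Let
  $t_i$ be the leading monomial of $q_i$. The initial ideals of $I$ and of $\mathrm{in}_y I$
  agree and are spanned by the multiples of the $y^{d_i} t_i$; since
  $I' \subseteq \mathrm{in}_y I$ already attains all these leading monomials, the two ideals are
  equal. If $y^j f \in I'$, then some $y^{d_i} t_i$ divides $y^j$ times the leading monomial of $f$,
  and because $t_i$ is free of $y$ it divides the leading monomial of $f$. So the $q_i$ are a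
  Groebner basis of $(I' : y^\infty)$, which is therefore $C$.

  For (b) and (e), a monomial outside $\mathrm{in}\,P$, and $y$ times a monomial outside
  $\mathrm{in}\,C$, are both outside $\mathrm{in}\,I$. By Macaulay's theorem this gives the
  inequality of Hilbert series. These monomials exhaust the complement of $\mathrm{in}\,I$ exactly
  if $y\,\mathrm{in}\,C \subseteq \mathrm{in}\,I$, which is equivalent to $I' = C \cap P$ and holds
  if all $d_i \le 1$.
\<close>

subsection \<open>Ideals\<close>

abbreviation lookup where "lookup \<equiv> Poly_Mapping.lookup"
abbreviation keys where "keys \<equiv> Poly_Mapping.keys"
abbreviation single where "single \<equiv> Poly_Mapping.single"

lemma type_algebra_sel [simp]:
  "carrier ring_of_type_algebra = UNIV"
  "x \<otimes>\<^bsub>ring_of_type_algebra\<^esub> z = x * z"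
  "x \<oplus>\<^bsub>ring_of_type_algebra\<^esub> z = x + z"
  "\<one>\<^bsub>ring_of_type_algebra\<^esub> = 1"
  "\<zero>\<^bsub>ring_of_type_algebra\<^esub> = 0"
  by (simp_all add: ring_of_type_algebra_def)

lemma type_algebra_set_add [simp]:
  "A <+>\<^bsub>ring_of_type_algebra\<^esub> B = {a + b |a b. a \<in> A \<and> b \<in> B}"
  by (auto simp: set_add_def set_mult_def ring_of_type_algebra_def)

lemma type_algebra_coset [simp]:
  "J +>\<^bsub>ring_of_type_algebra\<^esub> a = {h + a |h. h \<in> J}"
  by (auto simp: a_r_coset_def r_coset_def ring_of_type_algebra_def)

lemma ideal_type_algebra_iff:
  fixes J :: "'a::comm_ring_1 set"
  shows "ideal J ring_of_type_algebra \<longleftrightarrow>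
    0 \<in> J \<and> (\<forall>a\<in>J. \<forall>b\<in>J. a + b \<in> J) \<and> (\<forall>a\<in>J. \<forall>r. r * a \<in> J)"
proof
  assume "ideal J ring_of_type_algebra"
  then interpret ideal J "ring_of_type_algebra :: 'a ring" .
  show "0 \<in> J \<and> (\<forall>a\<in>J. \<forall>b\<in>J. a + b \<in> J) \<and> (\<forall>a\<in>J. \<forall>r. r * a \<in> J)"
    using additive_subgroup.zero_closed[OF additive_subgroup_axioms]
      additive_subgroup.a_closed[OF additive_subgroup_axioms] I_l_closed by simp
next
  assume J: "0 \<in> J \<and> (\<forall>a\<in>J. \<forall>b\<in>J. a + b \<in> J) \<and> (\<forall>a\<in>J. \<forall>r. r * a \<in> J)"
  interpret R: cring "ring_of_type_algebra :: 'a ring"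
    by (rule cring_from_type_algebra)
  have minus: "\<ominus>\<^bsub>ring_of_type_algebra\<^esub> a = - a" for a :: 'a
    by (rule R.minus_equality) simp_all
  show "ideal J ring_of_type_algebra"
  proof (rule idealI)
    show "ring (ring_of_type_algebra :: 'a ring)" by (rule R.ring_axioms)
    show "subgroup J (add_monoid ring_of_type_algebra)"
    proof (rule R.add.subgroupI)
      fix a assume "a \<in> J"
      then have "(-1) * a \<in> J" using J by blast
      then show "\<ominus>\<^bsub>ring_of_type_algebra\<^esub> a \<in> J" by (simp add: minus)
    qed (use J in auto)
  qed (use J in \<open>auto simp: mult.commute\<close>)
qed

context
  fixes J :: "'a::comm_ring_1 set"
  assumes J: "ideal J ring_of_type_algebra"
begin

lemma ideal_zero: "0 \<in> J"
  and ideal_add: "a \<in> J \<Longrightarrow> b \<in> J \<Longrightarrow> a + b \<in> J"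
  and ideal_mult: "a \<in> J \<Longrightarrow> r * a \<in> J"
  using J by (auto simp: ideal_type_algebra_iff)

lemma ideal_mult_right: "a \<in> J \<Longrightarrow> a * r \<in> J"
  using ideal_mult[of a r] by (simp add: mult.commute)

lemma ideal_uminus: "a \<in> J \<Longrightarrow> - a \<in> J"
  using ideal_mult[of a "-1"] by simp

lemma ideal_diff: "a \<in> J \<Longrightarrow> b \<in> J \<Longrightarrow> a - b \<in> J"
  using ideal_add[of a "- b"] ideal_uminus[of b] by simp

lemma ideal_sum: "(\<And>i. i \<in> A \<Longrightarrow> f i \<in> J) \<Longrightarrow> sum f A \<in> J"
  by (induction A rule: infinite_finite_induct) (auto intro: ideal_zero ideal_add)

end

lemma ideal_Idl:
  fixes S :: "'a::comm_ring_1 set"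
  shows "ideal (Idl\<^bsub>ring_of_type_algebra\<^esub> S) ring_of_type_algebra"
  by (rule ring.genideal_ideal[OF ring_from_type_algebra]) simp

lemma Idl_superset:
  fixes S :: "'a::comm_ring_1 set"
  shows "S \<subseteq> Idl\<^bsub>ring_of_type_algebra\<^esub> S"
  by (rule ring.genideal_self[OF ring_from_type_algebra]) simp

lemma Idl_least:
  fixes S :: "'a::comm_ring_1 set"
  shows "ideal J ring_of_type_algebra \<Longrightarrow> S \<subseteq> J \<Longrightarrow> Idl\<^bsub>ring_of_type_algebra\<^esub> S \<subseteq> J"
  by (rule ring.genideal_minimal[OF ring_from_type_algebra])

lemma ideal_set_add:
  fixes A B :: "'a::comm_ring_1 set"
  assumes "ideal A ring_of_type_algebra" "ideal B ring_of_type_algebra"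
  shows "ideal (A <+>\<^bsub>ring_of_type_algebra\<^esub> B) ring_of_type_algebra"
  by (rule ring.add_ideals[OF ring_from_type_algebra assms])

lemma ideal_Int:
  fixes A B :: "'a::comm_ring_1 set"
  assumes "ideal A ring_of_type_algebra" "ideal B ring_of_type_algebra"
  shows "ideal (A \<inter> B) ring_of_type_algebra"
  by (rule ring.i_intersect[OF ring_from_type_algebra assms])

lemma Idl_singleton:
  fixes x :: "'a::comm_ring_1"
  shows "Idl\<^bsub>ring_of_type_algebra\<^esub> {x} = range (\<lambda>b. x * b)"
proof
  have "ideal (range (\<lambda>b. x * b)) ring_of_type_algebra"
    unfolding ideal_type_algebra_iff
  proof (intro conjI ballI allI)
    show "0 \<in> range (\<lambda>b. x * b)" by (rule range_eqI[of _ _ 0]) simp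
    fix a assume "a \<in> range (\<lambda>b. x * b)"
    then obtain b where b: "a = x * b" by blast
    show "a + a' \<in> range (\<lambda>b. x * b)" if "a' \<in> range (\<lambda>b. x * b)" for a'
      using that b by (auto simp flip: distrib_left)
    show "r * a \<in> range (\<lambda>b. x * b)" for r
      unfolding b mult.left_commute[of r] by (rule rangeI)
  qed
  moreover have "x \<in> range (\<lambda>b. x * b)" by (rule range_eqI[of _ _ 1]) simp
  ultimately show "Idl\<^bsub>ring_of_type_algebra\<^esub> {x} \<subseteq> range (\<lambda>b. x * b)"
    by (intro Idl_least) auto
  show "range (\<lambda>b. x * b) \<subseteq> Idl\<^bsub>ring_of_type_algebra\<^esub> {x}"
    using Idl_superset[of "{x}"] by (auto intro: ideal_mult_right[OF ideal_Idl])
qed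

section \<open>Multiplication by a single term\<close>

lemma lookup_single_mult_add:
  fixes p :: "('v, 'k::field) mpoly"
  shows "lookup (single t c * p) (t + s) = c * lookup p s"
proof -
  have "lookup (single t c * p) (t + s) =
      (\<Sum>l. c * (\<Sum>u. lookup p u when t + s = l + u) when t = l)"
    by (simp add: lookup_mult lookup_single when_mult)
  also have "\<dots> = c * (\<Sum>u. lookup p u when s = u)"
    by simp
  finally show ?thesis by simp
qed

lemma keys_single_mult:
  fixes p :: "('v, 'k::field) mpoly"
  assumes "c \<noteq> 0"
  shows "keys (single t c * p) = (+) t ` keys p"
proof
  show "keys (single t c * p) \<subseteq> (+) t ` keys p"
    using keys_mult[of "single t c" p] by (auto split: if_splits)
  show "(+) t ` keys p \<subseteq> keys (single t c * p)"
    using assms by (auto simp: in_keys_iff lookup_single_mult_add)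
qed

lemma sum_singles: "(\<Sum>t\<in>keys p. single t (lookup p t)) = p"
  by (rule poly_mapping_eqI)
    (auto simp: lookup_sum lookup_single when_def sum.delta in_keys_iff)

text \<open>A polynomial is the finite sum of its terms, so additive closure reduces multiplication
  by \<open>r\<close> to multiplication by terms. The criterion suits sets described by
  exponents.\<close>

lemma ideal_mpoly_iff:
  fixes J :: "('v, 'k::field) mpoly set"
  shows "ideal J poly_ring \<longleftrightarrow>
    0 \<in> J \<and> (\<forall>a\<in>J. \<forall>b\<in>J. a + b \<in> J) \<and> (\<forall>a\<in>J. \<forall>t c. single t c * a \<in> J)"
proof
  assume J: "0 \<in> J \<and> (\<forall>a\<in>J. \<forall>b\<in>J. a + b \<in> J) \<and> (\<forall>a\<in>J. \<forall>t c. single t c * a \<in> J)"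
  have "r * a \<in> J" if "a \<in> J" for r a
  proof -
    have "(\<Sum>t\<in>A. single t (lookup r t) * a) \<in> J" for A
      by (induction A rule: infinite_finite_induct) (use J that in auto)
    from this[of "keys r"] show ?thesis
      by (simp add: sum_singles flip: sum_distrib_right)
  qed
  with J show "ideal J poly_ring" by (simp add: ideal_type_algebra_iff)
qed (simp add: ideal_type_algebra_iff)

subsection \<open>Weighted components\<close>

text \<open>The homogeneous component of weight \<open>j\<close>. The weight is a parameter because
  both the total degree and the exponent of \<open>y\<close> occur later.\<close>

definition wpart :: "('v monomial \<Rightarrow> nat) \<Rightarrow> nat \<Rightarrow> ('v, 'k::field) mpoly \<Rightarrow> ('v, 'k) mpoly"
  where "wpart w j p = Poly_Mapping.mapp (\<lambda>t c. c when w t = j) p"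

lemma lookup_wpart: "lookup (wpart w j p) t = (lookup p t when w t = j)"
  by (auto simp: wpart_def lookup_mapp when_def in_keys_iff)

lemma keys_wpart: "keys (wpart w j p) = {t \<in> keys p. w t = j}"
  by (auto simp: in_keys_iff lookup_wpart)

lemma wpart_zero [simp]: "wpart w j 0 = 0"
  by (rule poly_mapping_eqI) (simp add: lookup_wpart)

lemma wpart_add: "wpart w j (p + q) = wpart w j p + wpart w j q"
  by (rule poly_mapping_eqI) (simp add: lookup_wpart lookup_add when_add_distrib)

lemma wpart_idem:
  assumes "\<And>t. t \<in> keys p \<Longrightarrow> w t = e"
  shows "wpart w j p = (if j = e then p else 0)"
  by (rule poly_mapping_eqI) (use assms in \<open>auto simp: lookup_wpart when_def in_keys_iff\<close>)

lemma wpart_commute: "wpart w i (wpart w' j p) = wpart w' j (wpart w i p)"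
  by (rule poly_mapping_eqI) (simp add: lookup_wpart when_def)

text \<open>A term shifts weights by \<open>w t\<close>. The case distinction is essential: for
  \<open>j < w t\<close> the difference \<open>j - w t\<close> is truncated to 0 and would pick up
  the component of weight 0.\<close>

lemma wpart_single_mult:
  fixes p :: "('v, 'k::field) mpoly"
  assumes w: "\<And>s t. w (s + t) = w s + w t"
  shows "wpart w j (single t c * p) = (if w t \<le> j then single t c * wpart w (j - w t) p else 0)"
proof (cases "c = 0")
  case c: False
  have "lookup (wpart w j (single t c * p)) u =
      lookup (if w t \<le> j then single t c * wpart w (j - w t) p else 0) u" for u
  proof (cases "\<exists>s. u = t + s")
    case True
    then show ?thesis by (auto simp: lookup_wpart lookup_single_mult_add w when_def)
  next
    case False
    then have "u \<notin> keys (single t c * p')" for p' :: "('v, 'k) mpoly"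
      using c by (auto simp: keys_single_mult)
    then show ?thesis by (auto simp: lookup_wpart in_keys_iff)
  qed
  then show ?thesis by (rule poly_mapping_eqI)
qed simp

text \<open>For additive \<open>w\<close> this is the largest \<open>w\<close>-homogeneous ideal
  inside \<open>J\<close>. It serves to pass from generators to the whole ideal.\<close>

lemma ideal_wparts:
  fixes J :: "('v, 'k::field) mpoly set"
  assumes w: "\<And>s t. w (s + t) = w s + w t" and J: "ideal J poly_ring"
  shows "ideal {p. \<forall>j. wpart w j p \<in> J} poly_ring"
  by (auto simp: ideal_mpoly_iff wpart_add wpart_single_mult[OF w]
      intro: ideal_add[OF J] ideal_zero[OF J] ideal_mult[OF J])

lemma wpart_mem_Idl:
  fixes S :: "('v, 'k::field) mpoly set"
  assumes w: "\<And>s t. w (s + t) = w s + w t"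
    and S: "\<And>s j. s \<in> S \<Longrightarrow> wpart w j s \<in> Idl\<^bsub>poly_ring\<^esub> S"
    and f: "f \<in> Idl\<^bsub>poly_ring\<^esub> S"
  shows "wpart w j f \<in> Idl\<^bsub>poly_ring\<^esub> S"
  using Idl_least[OF ideal_wparts[OF w ideal_Idl], of S S] S f by blast

subsection \<open>Dickson's lemma\<close>

text \<open>A monotone subsequence exists. If it decreases, it is constant from the place where it
  attains its minimum, and the tail from there is taken instead.\<close>

lemma incseq_nat_subseq:
  fixes h :: "nat \<Rightarrow> nat"
  shows "\<exists>g. strict_mono g \<and> incseq (h \<circ> g)"
proof -
  obtain g where g: "strict_mono g" "monoseq (\<lambda>n. h (g n))"
    using seq_monosub[of h] by blast
  show ?thesis
  proof (cases "incseq (\<lambda>n. h (g n))")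
    case True
    then show ?thesis using g by (auto simp: comp_def)
  next
    case False
    then have dec: "decseq (\<lambda>n. h (g n))"
      using g by (simp add: monoseq_iff)
    obtain n where n: "\<And>k. h (g n) \<le> h (g k)"
      using ex_has_least_nat[of "\<lambda>_. True" 0 "\<lambda>n. h (g n)"] by auto
    have "h (g (n + k)) = h (g n)" for k
      using n[of "n + k"] decseqD[OF dec, of n "n + k"] by simp
    moreover have "strict_mono (\<lambda>k. g (n + k))"
      using g by (simp add: strict_mono_def)
    ultimately show ?thesis
      by (intro exI[of _ "\<lambda>k. g (n + k)"]) (simp add: incseq_def)
  qed
qed

text \<open>Coordinates are treated one after the other: a subsequence of an increasing sequence
  stays increasing, so thinning out for \<open>v\<close> keeps what was achieved on
  \<open>A\<close>.\<close>

lemma dickson_subseq: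
  fixes f :: "nat \<Rightarrow> 'v \<Rightarrow> nat"
  assumes "finite A"
  shows "\<exists>g. strict_mono g \<and> (\<forall>v\<in>A. incseq (\<lambda>n. f (g n) v))"
  using assms
proof induction
  case empty
  then show ?case by (auto intro: exI[of _ id] simp: strict_mono_def)
next
  case (insert v A)
  then obtain g where g: "strict_mono g" "\<forall>v\<in>A. incseq (\<lambda>n. f (g n) v)" by blast
  obtain g' where g': "strict_mono g'" "incseq ((\<lambda>n. f (g n) v) \<circ> g')"
    using incseq_nat_subseq by blast
  have "strict_mono (\<lambda>n. g (g' n))"
    using g(1) g'(1) by (simp add: strict_mono_def)
  moreover have "incseq (\<lambda>n. f (g (g' n)) u)" if "u \<in> insert v A" for u
    using that g(2) g' by (auto simp: incseq_def strict_mono_less_eq)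
  ultimately show ?case by (intro exI[of _ "\<lambda>n. g (g' n)"]) auto
qed

lemma monomial_dvdI:
  fixes s t :: "'v monomial"
  assumes "\<And>v. lookup s v \<le> lookup t v"
  shows "\<exists>u. t = s + u"
  by (rule exI[of _ "t - s"], rule poly_mapping_eqI) (simp add: lookup_add lookup_minus assms)

text \<open>In a sequence increasing in every coordinate, an earlier monomial divides each later
  one.\<close>

lemma dickson:
  fixes f :: "nat \<Rightarrow> 'v::finite monomial"
  shows "\<exists>i j u. i < j \<and> f j = f i + u"
proof -
  obtain g where g: "strict_mono g" "\<forall>v\<in>UNIV. incseq (\<lambda>n. lookup (f (g n)) v)"
    using dickson_subseq[of UNIV "\<lambda>n. lookup (f n)"] by auto
  have "\<exists>u. f (g 1) = f (g 0) + u"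
    using g(2) by (intro monomial_dvdI) (auto simp: incseq_def)
  moreover have "g 0 < g 1" using g(1) by (simp add: strict_mono_def)
  ultimately show ?thesis by blast
qed

subsection \<open>Leading monomials\<close>

locale monomial_order =
  fixes prec :: "'v::finite monomial \<Rightarrow> 'v monomial \<Rightarrow> bool"
  assumes order: "term_order prec"
begin

lemma prec_irrefl: "\<not> prec t t"
  using order by (auto simp: term_order_def irreflp_def)

lemma prec_trans: "prec s t \<Longrightarrow> prec t u \<Longrightarrow> prec s u"
  using order unfolding term_order_def by (blast dest: transpD)

lemma prec_total: "s \<noteq> t \<Longrightarrow> prec s t \<or> prec t s"
  using order unfolding term_order_def by (blast dest: totalpD)

lemma prec_add: "prec s t \<Longrightarrow> prec (u + s) (u + t)"
  using order unfolding term_order_def add.commute[of u] by blast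

lemma prec_self_add:
  assumes "u \<noteq> 0"
  shows "prec t (t + u)"
proof -
  have "prec (0 + t) (u + t)" using order assms unfolding term_order_def by blast
  then show ?thesis by (simp add: add.commute)
qed

text \<open>In an infinite descending chain, Dickson's lemma finds a later monomial that is a
  multiple of an earlier one. In a term order a multiple is never smaller, which contradicts the
  descent.\<close>

lemma wfp_prec: "wfp prec"
proof -
  have "\<not> (\<forall>i. prec (f (Suc i)) (f i))" for f
  proof
    assume f: "\<forall>i. prec (f (Suc i)) (f i)"
    have dec: "i < j \<Longrightarrow> prec (f j) (f i)" for i j
    proof (induction j)
      case (Suc j)
      have step: "prec (f (Suc j)) (f j)" using f by blast
      show ?case
        using Suc step prec_trans[OF step] by (cases "i = j") auto
    qed simp
    obtain i j u where ij: "i < j" "f j = f i + u" using dickson by blast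
    show False
    proof (cases "u = 0")
      case True
      then show False using dec[OF ij(1)] ij(2) prec_irrefl by simp
    next
      case False
      then have "prec (f i) (f j)" using ij(2) prec_self_add by simp
      then show False using prec_trans[of "f j" "f i" "f j"] dec[OF ij(1)] prec_irrefl by simp
    qed
  qed
  then show ?thesis unfolding wfp_def wf_iff_no_infinite_down_chain by simp
qed

text \<open>The leading exponent without its coefficient. The value at 0 is unspecified, whence the
  hypotheses \<open>p \<noteq> 0\<close> below.\<close>

definition lm :: "('v, 'k::field) mpoly \<Rightarrow> 'v monomial"
  where "lm p = (THE t. t \<in> keys p \<and> (\<forall>s\<in>keys p. s \<noteq> t \<longrightarrow> prec s t))"

lemma lm_eqI:
  assumes "t \<in> keys p" "\<And>s. s \<in> keys p \<Longrightarrow> s \<noteq> t \<Longrightarrow> prec s t"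
  shows "lm p = t"
  unfolding lm_def
proof (rule the_equality)
  fix u assume u: "u \<in> keys p \<and> (\<forall>s\<in>keys p. s \<noteq> u \<longrightarrow> prec s u)"
  show "u = t"
  proof (rule ccontr)
    assume "u \<noteq> t"
    then have "prec u t" "prec t u" using u assms by simp_all
    then show False using prec_trans[of u t u] prec_irrefl by simp
  qed
qed (use assms in \<open>simp add: assms\<close>)

lemma finite_max:
  assumes "finite A" "A \<noteq> {}"
  shows "\<exists>t\<in>A. \<forall>s\<in>A. s \<noteq> t \<longrightarrow> prec s t"
  using assms
proof (induction rule: finite_ne_induct)
  case (insert u A)
  then obtain t where t: "t \<in> A" "\<forall>s\<in>A. s \<noteq> t \<longrightarrow> prec s t" by blast
  show ?case
  proof (cases "prec t u")
    case True
    then have "\<forall>s\<in>A. prec s u"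
      using t prec_trans[of _ t u] by (metis (full_types))
    then show ?thesis by auto
  next
    case False
    then have "u \<noteq> t \<longrightarrow> prec u t" using prec_total by blast
    then show ?thesis using t by blast
  qed
qed simp

lemma
  assumes "p \<noteq> 0"
  shows lm_in_keys: "lm p \<in> keys p"
    and prec_lm: "s \<in> keys p \<Longrightarrow> s \<noteq> lm p \<Longrightarrow> prec s (lm p)"
proof -
  obtain t where t: "t \<in> keys p" "\<forall>s\<in>keys p. s \<noteq> t \<longrightarrow> prec s t"
    using finite_max[of "keys p"] assms by auto
  then have "lm p = t" by (intro lm_eqI) auto
  with t show "lm p \<in> keys p" "s \<in> keys p \<Longrightarrow> s \<noteq> lm p \<Longrightarrow> prec s (lm p)" by auto
qed

text \<open>This covers \<open>p = 0\<close> as well: whatever \<open>lm 0\<close> is, the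
  coefficient there is 0.\<close>

lemma init_term_eq: "init_term prec p = single (lm p) (lookup p (lm p))"
  by (simp add: init_term_def lm_def Let_def)

lemma lm_single_mult:
  assumes "c \<noteq> 0" "p \<noteq> 0"
  shows "lm (single u c * p) = u + lm p"
  using assms lm_in_keys prec_lm by (intro lm_eqI) (auto simp: keys_single_mult intro: prec_add)

lemma single_mult_nonzero:
  fixes p :: "('v, 'k::field) mpoly"
  assumes "c \<noteq> 0" "p \<noteq> 0"
  shows "single u c * p \<noteq> 0"
proof
  assume "single u c * p = 0"
  then have "(+) u ` keys p = {}" using keys_single_mult[OF assms(1), of u p] by simp
  then show False using assms(2) by simp
qed

text \<open>One step of the division algorithm: the quotient of the leading coefficients is the
  scalar that cancels the common leading monomial.\<close>

lemma cancel_lead: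
  fixes f g :: "('v, 'k::field) mpoly"
  assumes "f \<noteq> 0" "g \<noteq> 0" "lm f = lm g"
  shows "\<exists>c. \<forall>s\<in>keys (f - single 0 c * g). prec s (lm f)"
proof -
  let ?c = "lookup f (lm f) / lookup g (lm g)"
  have g: "lookup g (lm g) \<noteq> 0" using lm_in_keys[OF assms(2)] by (simp add: in_keys_iff)
  have c: "lookup (single 0 a * g) s = a * lookup g s" for a s
    using lookup_single_mult_add[of 0 a g s] by simp
  have "prec s (lm f)" if "s \<in> keys (f - single 0 ?c * g)" for s
  proof -
    have "s \<noteq> lm f" using that g assms(3) by (auto simp: in_keys_iff lookup_minus c)
    moreover have "s \<in> keys f \<or> s \<in> keys g"
      using that by (auto simp: in_keys_iff lookup_minus c)
    ultimately show ?thesis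
      using prec_lm[OF assms(1), of s] prec_lm[OF assms(2), of s] assms(3) by auto
  qed
  then show ?thesis by blast
qed

section \<open>Leading monomials of sets and Groebner bases\<close>

text \<open>The exponents of the monomial ideal generated by the initial terms of \<open>S\<close>.
  Since multiples are included, one operator serves both ideals and generating sets, and Groebner
  bases are compared through sets of exponents.\<close>

definition leads :: "('v, 'k::field) mpoly set \<Rightarrow> 'v monomial set"
  where "leads S = {lm g + u |g u. g \<in> S \<and> g \<noteq> 0}"

lemma leads_mono: "S \<subseteq> T \<Longrightarrow> leads S \<subseteq> leads T"
  by (auto simp: leads_def)

lemma lm_in_leads: "g \<in> S \<Longrightarrow> g \<noteq> 0 \<Longrightarrow> lm g \<in> leads S"
  unfolding leads_def by (auto intro: exI[of _ g] exI[of _ 0])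

lemma leads_add: "t \<in> leads S \<Longrightarrow> u + t \<in> leads S"
  unfolding leads_def by clarify (metis add.left_commute)

lemma leads_ideal:
  assumes J: "ideal J poly_ring" and "t \<in> leads J"
  obtains g where "g \<in> J" "g \<noteq> 0" "lm g = t"
proof -
  obtain g u where g: "g \<in> J" "g \<noteq> 0" "t = lm g + u" using assms(2) by (auto simp: leads_def)
  show thesis
    by (rule that[of "single u 1 * g"])
      (use g in \<open>simp_all add: ideal_mult[OF J] single_mult_nonzero lm_single_mult add.commute\<close>)
qed

lemma leads_subset_if:
  assumes "ideal J poly_ring" "\<And>f. f \<in> J \<Longrightarrow> f \<noteq> 0 \<Longrightarrow> lm f \<in> leads S"
  shows "leads J \<subseteq> leads S"
proof
  fix t assume "t \<in> leads J"
  then obtain g where "g \<in> J" "g \<noteq> 0" "lm g = t" by (rule leads_ideal[OF assms(1)])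
  then show "t \<in> leads S" using assms(2) by blast
qed

text \<open>A polynomial lies in a monomial ideal exactly if each of its monomials does. Over a
  field the leading coefficients are units, so the generators can be scaled to any
  coefficient.\<close>

lemma Idl_init_term:
  fixes S :: "('v, 'k::field) mpoly set"
  shows "Idl\<^bsub>poly_ring\<^esub> (init_term prec ` S) = {p. keys p \<subseteq> leads S}"
proof
  have "ideal {p :: ('v, 'k) mpoly. keys p \<subseteq> leads S} poly_ring"
    unfolding ideal_mpoly_iff
  proof (intro conjI ballI allI)
    fix a :: "('v, 'k) mpoly" and t c assume "a \<in> {p. keys p \<subseteq> leads S}"
    then have "(+) t ` keys a \<subseteq> leads S" by (auto intro!: leads_add)
    then show "single t c * a \<in> {p. keys p \<subseteq> leads S}"
      by (cases "c = 0") (simp_all add: keys_single_mult)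
  next
    fix a b :: "('v, 'k) mpoly"
    assume "a \<in> {p. keys p \<subseteq> leads S}" "b \<in> {p. keys p \<subseteq> leads S}"
    then show "a + b \<in> {p. keys p \<subseteq> leads S}" using keys_add[of a b] by blast
  qed simp
  then show "Idl\<^bsub>poly_ring\<^esub> (init_term prec ` S) \<subseteq> {p. keys p \<subseteq> leads S}"
  proof (rule Idl_least)
    show "init_term prec ` S \<subseteq> {p. keys p \<subseteq> leads S}"
    proof clarify
      fix g t assume "g \<in> S" "t \<in> keys (init_term prec g)"
      then have "t = lm g \<and> g \<noteq> 0" by (cases "g = 0") (simp_all add: init_term_eq split: if_splits)
      then show "t \<in> leads S" using lm_in_leads \<open>g \<in> S\<close> by blast
    qed
  qed
next
  have *: "single t c \<in> Idl\<^bsub>poly_ring\<^esub> (init_term prec ` S)" if t: "t \<in> leads S" for t and c :: 'k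
  proof -
    obtain g u where g: "t = lm g + u" "g \<in> S" "g \<noteq> 0" using t by (auto simp: leads_def)
    then have "lookup g (lm g) \<noteq> 0" using lm_in_keys by (simp add: in_keys_iff)
    then have "single t c = single u (c / lookup g (lm g)) * init_term prec g"
      unfolding g(1) add.commute[of "lm g"] by (simp add: init_term_eq mult_single)
    moreover have "init_term prec g \<in> Idl\<^bsub>poly_ring\<^esub> (init_term prec ` S)"
      using g(2) by (intro subsetD[OF Idl_superset] imageI)
    ultimately show ?thesis using ideal_mult[OF ideal_Idl] by metis
  qed
  show "{p. keys p \<subseteq> leads S} \<subseteq> Idl\<^bsub>poly_ring\<^esub> (init_term prec ` S)"
  proof
    fix p assume "p \<in> {p :: ('v, 'k) mpoly. keys p \<subseteq> leads S}"
    then have "(\<Sum>t\<in>keys p. single t (lookup p t)) \<in> Idl\<^bsub>poly_ring\<^esub> (init_term prec ` S)"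
      by (intro ideal_sum[OF ideal_Idl] *) auto
    then show "p \<in> Idl\<^bsub>poly_ring\<^esub> (init_term prec ` S)" by (simp add: sum_singles)
  qed
qed

lemma init_ideal_eq: "init_ideal prec J = {p. keys p \<subseteq> leads J}"
  by (simp add: init_ideal_def Idl_init_term)

lemma groebner_basis_iff:
  fixes G :: "('v, 'k::field) mpoly set"
  shows "groebner_basis prec G J \<longleftrightarrow> finite G \<and> G \<subseteq> J \<and> leads J \<subseteq> leads G"
proof -
  \<comment> \<open>Testing with the monomial \<open>t\<close> of coefficient 1 recovers a set of
    exponents from the set of polynomials supported on it.\<close>
  have *: "A \<subseteq> B" if "{p :: ('v, 'k) mpoly. keys p \<subseteq> A} = {p. keys p \<subseteq> B}" for A B
  proof
    fix t assume "t \<in> A"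
    then have "single t (1::'k) \<in> {p. keys p \<subseteq> A}" by simp
    then show "t \<in> B" unfolding that by simp
  qed
  have "{p :: ('v, 'k) mpoly. keys p \<subseteq> A} = {p. keys p \<subseteq> B} \<longleftrightarrow> A = B" for A B
    using *[of A B] *[of B A] by (metis subset_antisym)
  then have "groebner_basis prec G J \<longleftrightarrow> finite G \<and> G \<subseteq> J \<and> leads J = leads G"
    unfolding groebner_basis_def init_ideal_eq Idl_init_term by simp
  then show ?thesis using leads_mono[of G J] by auto
qed

lemma leads_groebner_basis: "groebner_basis prec G J \<Longrightarrow> leads J = leads G"
  by (simp add: groebner_basis_iff leads_mono subset_antisym)

lemma leads_Un: "leads (S \<union> T) = leads S \<union> leads T"
  by (auto simp: leads_def)

lemma leads_image_iff:
  assumes "\<And>i. i \<in> B \<Longrightarrow> f i \<noteq> 0" "\<And>i. i \<in> B \<Longrightarrow> lm (f i) = l i"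
  shows "t \<in> leads (f ` B) \<longleftrightarrow> (\<exists>i\<in>B. \<exists>u. t = l i + u)"
proof -
  have "t \<in> leads (f ` B) \<longleftrightarrow> (\<exists>i\<in>B. f i \<noteq> 0 \<and> (\<exists>u. t = lm (f i) + u))"
    unfolding leads_def by blast
  then show ?thesis using assms by simp
qed

text \<open>Well-founded induction on the leading monomial of \<open>f\<close>: an element of
  \<open>J'\<close> with the same leading monomial cancels it, and the difference lies in
  \<open>J\<close> and is 0 or has a smaller leading monomial.\<close>

lemma ideal_eq_if_leads:
  fixes J J' :: "('v, 'k::field) mpoly set"
  assumes J: "ideal J poly_ring" and J': "ideal J' poly_ring"
    and sub: "J' \<subseteq> J" and leads: "leads J \<subseteq> leads J'"
  shows "J' = J"
proof
  have "\<forall>f\<in>J. f \<noteq> 0 \<longrightarrow> lm f = t \<longrightarrow> f \<in> J'" for t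
  proof (induction t rule: wfp_induct_rule[OF wfp_prec])
    case (1 t)
    show ?case
    proof (intro ballI impI)
      fix f assume f: "f \<in> J" "f \<noteq> 0" "lm f = t"
      then have "lm f \<in> leads J'" using lm_in_leads leads by blast
      then obtain g where g: "g \<in> J'" "g \<noteq> 0" "lm g = lm f" using leads_ideal[OF J'] by blast
      obtain c where c: "\<forall>s\<in>keys (f - single 0 c * g). prec s (lm f)"
        using cancel_lead[OF f(2) g(2)] g(3) by auto
      have cg: "single 0 c * g \<in> J'" using g ideal_mult[OF J'] by blast
      then have "f - single 0 c * g \<in> J" using f ideal_diff[OF J] sub by blast
      then have "f - single 0 c * g \<in> J'"
        using 1 c f(3) lm_in_keys[of "f - single 0 c * g"] ideal_zero[OF J'] by force
      then show "f \<in> J'" using ideal_add[OF J' _ cg] by fastforce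
    qed
  qed
  then show "J \<subseteq> J'" using ideal_zero[OF J'] by (metis subsetI)
qed (rule sub)

text \<open>Elements of \<open>J\<close> that realise all leading monomials also generate
  \<open>J\<close>: the comparison above applies to \<open>Idl G\<close> inside
  \<open>J\<close>.\<close>

lemma
  assumes J: "ideal J poly_ring" and G: "finite G" "G \<subseteq> J" "leads J \<subseteq> leads G"
  shows groebner_basisI: "groebner_basis prec G J"
    and Idl_groebner_basis: "Idl\<^bsub>poly_ring\<^esub> G = J"
proof -
  show "groebner_basis prec G J" using G by (simp add: groebner_basis_iff)
  have "leads G \<subseteq> leads (Idl\<^bsub>poly_ring\<^esub> G)" by (intro leads_mono Idl_superset)
  then show "Idl\<^bsub>poly_ring\<^esub> G = J"
    using ideal_eq_if_leads[OF J ideal_Idl Idl_least[OF J G(2)]] G(3) by blast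
qed

end

subsection \<open>Hilbert functions\<close>

lemma mono_degree_add: "mono_degree (s + t) = mono_degree s + mono_degree t"
  by (simp add: mono_degree_def lookup_add sum.distrib)

lemma mono_degree_single: "mono_degree (single v n) = n"
  by (simp add: mono_degree_def lookup_single when_def)

lemma finite_mono_degree: "finite {t :: 'v::finite monomial. mono_degree t = k}"
proof (rule finite_imageD)
  have "lookup ` {t :: 'v monomial. mono_degree t = k} \<subseteq> {f. \<forall>v. (v \<in> UNIV \<longrightarrow> f v \<in> {..k}) \<and> (v \<notin> UNIV \<longrightarrow> f v = 0)}"
    by (auto simp: mono_degree_def intro: member_le_sum)
  then show "finite (lookup ` {t :: 'v monomial. mono_degree t = k})"
    by (rule finite_subset) (rule finite_set_of_finite_funs; simp)
  show "inj_on lookup {t :: 'v monomial. mono_degree t = k}"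
    by (rule inj_onI) (simp only: poly_mapping.lookup_inject)
qed

text \<open>A homogeneous generator has only itself and 0 as components, and it suffices to check
  components of generators.\<close>

lemma homogeneous_ideal_wpart:
  assumes "homogeneous_ideal J" "f \<in> J"
  shows "wpart mono_degree k f \<in> J"
proof -
  obtain S where S: "S \<subseteq> (\<Union>k. hom_piece k)" "J = Idl\<^bsub>poly_ring\<^esub> S"
    using assms(1) by (auto simp: homogeneous_ideal_def)
  have "wpart mono_degree j s \<in> J" if s: "s \<in> S" for s j
  proof -
    obtain e where "s \<in> hom_piece e" using S(1) s by blast
    then have "wpart mono_degree j s = (if j = e then s else 0)"
      by (intro wpart_idem) (simp add: hom_piece_def)
    moreover have "s \<in> J" using s S(2) Idl_superset by auto
    moreover have "0 \<in> J" unfolding S(2) by (rule ideal_zero[OF ideal_Idl])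
    ultimately show ?thesis by simp
  qed
  then show ?thesis
    using wpart_mem_Idl[where w = mono_degree and S = S and f = f and j = k, OF mono_degree_add]
      assms(2) unfolding S(2) by blast
qed

lemma coset_eq_iff:
  fixes J :: "'a::comm_ring_1 set"
  assumes J: "ideal J ring_of_type_algebra"
  shows "J +>\<^bsub>ring_of_type_algebra\<^esub> a = J +>\<^bsub>ring_of_type_algebra\<^esub> b \<longleftrightarrow> a - b \<in> J"
proof
  assume eq: "J +>\<^bsub>ring_of_type_algebra\<^esub> a = J +>\<^bsub>ring_of_type_algebra\<^esub> b"
  have "a \<in> J +>\<^bsub>ring_of_type_algebra\<^esub> a"
    using ideal_zero[OF J] by (auto intro: exI[of _ 0])
  then show "a - b \<in> J" unfolding eq by auto
next
  have sub: "J +>\<^bsub>ring_of_type_algebra\<^esub> a \<subseteq> J +>\<^bsub>ring_of_type_algebra\<^esub> b" if "a - b \<in> J" for a b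
  proof
    fix x assume "x \<in> J +>\<^bsub>ring_of_type_algebra\<^esub> a"
    then obtain h where h: "h \<in> J" "x = h + a" by auto
    then have "x = (h + (a - b)) + b" by simp
    then show "x \<in> J +>\<^bsub>ring_of_type_algebra\<^esub> b"
      using ideal_add[OF J h(1) that] unfolding type_algebra_coset by blast
  qed
  assume "a - b \<in> J"
  then show "J +>\<^bsub>ring_of_type_algebra\<^esub> a = J +>\<^bsub>ring_of_type_algebra\<^esub> b"
    using sub[of a b] sub[of b a] ideal_uminus[OF J, of "a - b"] by (simp del: type_algebra_coset)
qed

text \<open>The scalars are the image of a field under a ring homomorphism;
  \<open>1 \<notin> J\<close> keeps 1 and 0 apart in the quotient.\<close>

lemma quot_scalars_subfield:
  fixes J :: "('v, 'k::field) mpoly set"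
  assumes J: "ideal J poly_ring" and "1 \<notin> J"
  shows "subfield (quot_scalars J) (poly_ring Quot J)"
proof -
  interpret ideal J "poly_ring :: ('v, 'k) mpoly ring" by (rule J)
  interpret K: field "ring_of_type_algebra :: 'k ring" by (rule field_from_type_algebra)
  interpret h: ring_hom_ring "ring_of_type_algebra :: 'k ring" "poly_ring Quot J"
    "\<lambda>c. J +>\<^bsub>poly_ring\<^esub> const c"
  proof (rule ring_hom_ringI2[OF K.ring_axioms quotient_is_ring])
    have "const \<in> ring_hom (ring_of_type_algebra :: 'k ring) (poly_ring :: ('v, 'k) mpoly ring)"
      by (rule ring_hom_memI) (simp_all add: const_def mult_single single_add)
    from ring_hom_trans[OF this rcos_ring_hom]
    show "(\<lambda>c. J +>\<^bsub>poly_ring\<^esub> const c) \<in> ring_hom ring_of_type_algebra (poly_ring Quot J)"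
      by (simp add: comp_def del: type_algebra_coset)
  qed
  have "\<one>\<^bsub>poly_ring Quot J\<^esub> \<noteq> \<zero>\<^bsub>poly_ring Quot J\<^esub>"
  proof
    assume "\<one>\<^bsub>poly_ring Quot J\<^esub> = \<zero>\<^bsub>poly_ring Quot J\<^esub>"
    then have "J +>\<^bsub>poly_ring\<^esub> 1 = J +>\<^bsub>poly_ring\<^esub> 0"
      by (simp add: FactRing_def)
    then show False using assms coset_eq_iff[OF J, of 1 0] by simp
  qed
  from h.img_is_subfield(2)[OF K.carrier_is_subfield this] show ?thesis
    by (simp add: quot_scalars_def del: type_algebra_coset)
qed

section \<open>Standard monomials and Macaulay's theorem\<close>

context monomial_order
begin

definition standard :: "('v, 'k::field) mpoly set \<Rightarrow> nat \<Rightarrow> 'v monomial set"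
  where "standard J k = {t. mono_degree t = k \<and> t \<notin> leads J}"

lemma finite_standard: "finite (standard J k)"
  using finite_mono_degree[of k] by (rule rev_finite_subset) (simp add: standard_def Collect_mono)

text \<open>Normal forms add up, so it suffices to reduce each term of \<open>p\<close>.\<close>

lemma reduce_sum:
  fixes J :: "('v, 'k::field) mpoly set"
  assumes J: "ideal J poly_ring"
    and red: "\<And>t c. t \<in> keys p \<Longrightarrow> \<exists>e. keys e \<subseteq> A \<and> single t c - e \<in> J"
  shows "\<exists>e. keys e \<subseteq> A \<and> p - e \<in> J"
proof -
  have "\<forall>t\<in>keys p. \<exists>e. keys e \<subseteq> A \<and> single t (lookup p t) - e \<in> J"
    by (intro ballI red)
  from bchoice[OF this] obtain e
    where e: "\<forall>t\<in>keys p. keys (e t) \<subseteq> A \<and> single t (lookup p t) - e t \<in> J" ..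
  have "keys (\<Sum>t\<in>keys p. e t) \<subseteq> A"
    by (rule order_trans[OF keys_sum]) (use e in \<open>simp add: UN_subset_iff\<close>)
  moreover have "p - (\<Sum>t\<in>keys p. e t) = (\<Sum>t\<in>keys p. single t (lookup p t) - e t)"
    by (simp add: sum_subtractf sum_singles)
  moreover have "(\<Sum>t\<in>keys p. single t (lookup p t) - e t) \<in> J"
    by (rule ideal_sum[OF J]) (use e in blast)
  ultimately show ?thesis by (intro exI[of _ "\<Sum>t\<in>keys p. e t"] conjI) simp_all
qed

text \<open>The division algorithm as well-founded induction on \<open>t\<close>. Dividing by the
  degree \<open>k\<close> component of an element of \<open>J\<close> keeps all remainders in degree
  \<open>k\<close>, as \<open>standard J k\<close> demands.\<close>

lemma reduce_single:
  fixes J :: "('v, 'k::field) mpoly set"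
  assumes J: "ideal J poly_ring" and hom: "\<And>f. f \<in> J \<Longrightarrow> wpart mono_degree k f \<in> J"
  shows "mono_degree t = k \<Longrightarrow> \<exists>e. keys e \<subseteq> standard J k \<and> single t c - e \<in> J"
proof (induction t arbitrary: c rule: wfp_induct_rule[OF wfp_prec])
  case (1 t)
  show ?case
  proof (cases "t \<in> leads J")
    case False
    then show ?thesis using 1(2) ideal_zero[OF J]
      by (intro exI[of _ "single t c"]) (simp add: standard_def)
  next
    case True
    then obtain g where g: "g \<in> J" "g \<noteq> 0" "lm g = t" by (rule leads_ideal[OF J])
    define h where "h = wpart mono_degree k g"
    have t: "t \<in> keys h" using lm_in_keys[OF g(2)] g(3) 1(2) by (simp add: h_def keys_wpart)
    have lt: "prec s t" if "s \<in> keys h" "s \<noteq> t" for s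
      using prec_lm[OF g(2), of s] that g(3) by (simp add: h_def keys_wpart)
    define a where "a = c / lookup h t"
    have h: "single 0 a * h \<in> J" unfolding h_def by (intro ideal_mult[OF J] hom g(1))
    define f where "f = single t c - single 0 a * h"
    have lookup_f: "lookup f s = lookup (single t c) s - a * lookup h s" for s
      using lookup_single_mult_add[of 0 a h s] by (simp add: f_def lookup_minus)
    have f: "prec s t \<and> mono_degree s = k" if s: "s \<in> keys f" for s
    proof -
      have "lookup f t = 0" using t by (simp add: lookup_f a_def in_keys_iff)
      then have "s \<noteq> t" using s by (auto simp: in_keys_iff)
      then have "s \<in> keys h" using s by (auto simp: in_keys_iff lookup_f lookup_single when_def)
      then show ?thesis using lt \<open>s \<noteq> t\<close> by (simp add: h_def keys_wpart)
    qed
    \<comment> \<open>All monomials of \<open>f\<close> are smaller than \<open>t\<close> and of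
      degree \<open>k\<close>, hence reducible by the induction hypothesis.\<close>
    obtain e where e: "keys e \<subseteq> standard J k" "f - e \<in> J"
      using reduce_sum[OF J, of f "standard J k"] 1(1) f by blast
    have "single t c - e = (f - e) + single 0 a * h" by (simp add: f_def)
    then have "single t c - e \<in> J" using ideal_add[OF J e(2) h] by (simp only:)
    then show ?thesis using e(1) by blast
  qed
qed

text \<open>Adjoining one monomial at a time raises the dimension by one. A relation modulo
  \<open>J\<close> among monomials of \<open>A\<close> would be a nonzero element of
  \<open>J\<close> with leading monomial in \<open>A\<close>, which avoids
  \<open>leads J\<close>.\<close>

lemma dimension_standard:
  fixes J :: "('v, 'k::field) mpoly set"
  assumes J: "ideal J poly_ring" and "finite A" "A \<inter> leads J = {}"
  shows "ring.dimension (poly_ring Quot J) (card A) (quot_scalars J)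
    ((\<lambda>p. J +>\<^bsub>poly_ring\<^esub> p) ` {p. keys p \<subseteq> A})"
proof -
  interpret J: ideal J "poly_ring :: ('v, 'k) mpoly ring" by (rule J)
  interpret Q: ring "poly_ring Quot J" by (rule J.quotient_is_ring)
  interpret h: ring_hom_ring "poly_ring :: ('v, 'k) mpoly ring" "poly_ring Quot J"
    "\<lambda>p. J +>\<^bsub>poly_ring\<^esub> p"
    by (rule J.rcos_ring_hom_ring)
  note [simp del] = type_algebra_coset
  show ?thesis using assms(2,3)
  proof (induction A)
    case empty
    have "{p :: ('v, 'k) mpoly. keys p \<subseteq> {}} = {0}" by auto
    then show ?case using h.hom_zero by simp
  next
    case (insert t A)
    let ?\<pi> = "\<lambda>p. J +>\<^bsub>poly_ring\<^esub> p"
    let ?E = "?\<pi> ` {p. keys p \<subseteq> A}"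
    have new: "?\<pi> (single t 1) \<notin> ?E"
    proof
      assume "?\<pi> (single t 1) \<in> ?E"
      then obtain e where e: "keys e \<subseteq> A" "single t 1 - e \<in> J"
        using coset_eq_iff[OF J] by auto
      have "lookup e t = 0"
        using e(1) insert.hyps by (auto simp: in_keys_iff)
      then have "t \<in> keys (single t 1 - e)"
        by (simp add: in_keys_iff lookup_minus)
      then have "single t 1 - e \<noteq> 0" by auto
      then have "lm (single t 1 - e) \<in> leads J" "lm (single t 1 - e) \<in> keys (single t 1 - e)"
        using e(2) by (auto intro: lm_in_leads lm_in_keys)
      moreover have "keys (single t 1 - e) \<subseteq> insert t A"
        using keys_diff[of "single t 1" e] e(1) by auto
      ultimately show False using insert.prems by blast
    qed
    have "ring.dimension (poly_ring Quot J) (Suc (card A)) (quot_scalars J)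
        (Q.line_extension (quot_scalars J) (?\<pi> (single t 1)) ?E)"
      using insert.IH insert.prems new h.hom_closed by (intro Q.Suc_dim) auto
    \<comment> \<open>A scalar multiple of the class of \<open>t\<close> plus an old class is the
      class of some \<open>single t c + e\<close>, and these sums are exactly the polynomials
      supported on \<open>insert t A\<close>.\<close>
    moreover have "Q.line_extension (quot_scalars J) (?\<pi> (single t 1)) ?E =
        ?\<pi> ` {p. keys p \<subseteq> insert t A}"
    proof -
      have "?\<pi> (single t c + e) =
          ?\<pi> (const c) \<otimes>\<^bsub>poly_ring Quot J\<^esub> ?\<pi> (single t 1) \<oplus>\<^bsub>poly_ring Quot J\<^esub> ?\<pi> e" for c e
        using h.hom_add[of "single t c" e] h.hom_mult[of "const c" "single t 1"]
        by (simp add: const_def mult_single)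
      then have "Q.line_extension (quot_scalars J) (?\<pi> (single t 1)) ?E =
          {?\<pi> (single t c + e) |c e. keys e \<subseteq> A}"
        by (auto simp: Q.line_extension_def set_add_def' r_coset_def quot_scalars_def)
      also have "\<dots> = ?\<pi> ` {single t c + e |c e. keys e \<subseteq> A}" by auto
      also have "{single t c + e |c e. keys e \<subseteq> A} = {p :: ('v, 'k) mpoly. keys p \<subseteq> insert t A}"
      proof (intro equalityI subsetI)
        fix p :: "('v, 'k) mpoly" assume "p \<in> {single t c + e |c e. keys e \<subseteq> A}"
        then obtain c e where "p = single t c + e" "keys e \<subseteq> A" by blast
        then show "p \<in> {p. keys p \<subseteq> insert t A}"
          using keys_add[of "single t c" e] by (auto split: if_splits)
      next
        fix p :: "('v, 'k) mpoly" assume p: "p \<in> {p. keys p \<subseteq> insert t A}"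
        have "keys (p - single t (lookup p t)) \<subseteq> A"
          using p by (auto simp: in_keys_iff lookup_minus lookup_single when_def split: if_splits)
        moreover have "p = single t (lookup p t) + (p - single t (lookup p t))" by simp
        ultimately show "p \<in> {single t c + e |c e. keys e \<subseteq> A}" by blast
      qed
      finally show ?thesis .
    qed
    ultimately show ?case using insert.hyps by simp
  qed
qed

text \<open>Macaulay: the classes of the standard monomials of degree \<open>k\<close> form a basis of the
  degree \<open>k\<close> piece of the quotient.\<close>

lemma hilbert_series_nth:
  fixes J :: "('v, 'k::field) mpoly set"
  assumes J: "ideal J poly_ring" and hom: "\<And>f k. f \<in> J \<Longrightarrow> wpart mono_degree k f \<in> J"
  shows "fps_nth (hilbert_series J) k = int (card (standard J k))"
proof -
  interpret J: ideal J "poly_ring :: ('v, 'k) mpoly ring" by (rule J)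
  interpret Q: ring "poly_ring Quot J" by (rule J.quotient_is_ring)
  note [simp del] = type_algebra_coset
  have "quot_piece J k = (\<lambda>p. J +>\<^bsub>poly_ring\<^esub> p) ` {p. keys p \<subseteq> standard J k}"
    unfolding quot_piece_def
  proof (intro equalityI image_subsetI)
    fix p :: "('v, 'k) mpoly" assume "p \<in> hom_piece k"
    then obtain e where e: "keys e \<subseteq> standard J k" "p - e \<in> J"
      using reduce_sum[OF J, of p "standard J k"] reduce_single[OF J hom, where k = k]
      by (auto simp: hom_piece_def)
    then show "J +>\<^bsub>poly_ring\<^esub> p \<in> (\<lambda>p. J +>\<^bsub>poly_ring\<^esub> p) ` {p. keys p \<subseteq> standard J k}"
      using coset_eq_iff[OF J, of p e] by blast
  qed (auto simp: hom_piece_def standard_def)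
  then have dim: "Q.dimension (card (standard J k)) (quot_scalars J) (quot_piece J k)"
    using dimension_standard[OF J finite_standard[of J k]] by (auto simp: standard_def)
  have "Q.dim (quot_scalars J) (quot_piece J k) = card (standard J k)"
  proof (cases "1 \<in> J")
    case False
    then show ?thesis
      using Q.dimI[OF quot_scalars_subfield[OF J] dim] by (simp add: over_def)
  next
    \<comment> \<open>For the unit ideal the quotient is the zero ring and the scalars form no
      subfield, so \<open>dim\<close> is evaluated from its definition. The rule
      \<open>Suc_dim\<close> never applies, since every vector already lies in the zero
      space.\<close>
    case True
    have one: "J +>\<^bsub>poly_ring\<^esub> p = J +>\<^bsub>poly_ring\<^esub> 0" for p
      using coset_eq_iff[OF J, of p 0] ideal_mult[OF J True, of p] by simp
    have carrier: "carrier (poly_ring Quot J) \<subseteq> {J +>\<^bsub>poly_ring\<^esub> 0}"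
      using one by (auto simp: FactRing_def A_RCOSETS_def')
    have zero: "\<zero>\<^bsub>poly_ring Quot J\<^esub> = J +>\<^bsub>poly_ring\<^esub> 0"
      using carrier Q.zero_closed by blast
    have dim0: "n = 0 \<and> E = {J +>\<^bsub>poly_ring\<^esub> 0}" if "Q.dimension n K E" for n K E
      using that
    proof induction
      case (Suc_dim v E n K)
      then show ?case using carrier by blast
    qed (simp add: zero)
    show ?thesis
      unfolding Q.dim_def
    proof (rule the_equality)
      show "Q.dimension (card (standard J k)) (quot_scalars J) (quot_piece J k)" by (rule dim)
      fix n assume "Q.dimension n (quot_scalars J) (quot_piece J k)"
      from dim0[OF this] dim0[OF dim] show "n = card (standard J k)" by simp
    qed
  qed
  then show ?thesis by (simp add: hilbert_series_def)
qed

end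

subsection \<open>Initial forms\<close>

lemma var_power_eq: "var v ^ n = single (single v n) 1"
  by (induction n) (simp_all add: var_def mult_single flip: single_add)

lemma var_dvdI:
  fixes p :: "('v, 'k::field) mpoly"
  assumes "\<And>t. t \<in> keys p \<Longrightarrow> 0 < lookup t v"
  shows "var v dvd p"
proof -
  have "var v dvd single t (lookup p t)" if "t \<in> keys p" for t
  proof -
    have "t = single v 1 + (t - single v 1)"
      using assms[OF that] by (intro poly_mapping_eqI) (auto simp: lookup_add lookup_minus lookup_single when_def)
    then have "single t (lookup p t) = var v * single (t - single v 1) (lookup p t)"
      by (simp add: var_def mult_single)
    then show ?thesis by (rule dvdI)
  qed
  then have "var v dvd (\<Sum>t\<in>keys p. single t (lookup p t))" by (intro dvd_sum) auto
  then show ?thesis by (simp add: sum_singles)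
qed

text \<open>Compared coordinatewise, \<open>s\<close> does not involve \<open>v\<close>, and in the
  other coordinates the powers of \<open>v\<close> are invisible. This is what removes powers of
  \<open>y\<close> from divisibility by \<open>lm (q i)\<close>.\<close>

lemma monomial_cancel_var:
  fixes s t u :: "'v monomial"
  assumes "single v a + t = single v b + s + u" "lookup s v = 0"
  shows "\<exists>w. t = s + w"
proof (rule monomial_dvdI)
  fix x
  have "lookup (single v a + t) x = lookup (single v b + s + u) x" using assms(1) by simp
  then show "lookup s x \<le> lookup t x"
    using assms(2) by (cases "x = v") (simp_all add: lookup_add lookup_single when_def)
qed

lemma monomial_split_var:
  fixes t :: "'v monomial"
  assumes "n \<le> lookup t v"
  obtains u where "t = single v n + u"
proof -
  have "\<exists>u. t = single v n + u"
    by (rule monomial_dvdI) (use assms in \<open>auto simp: lookup_single when_def\<close>)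
  then show thesis using that by blast
qed

lemma ideal_saturation:
  fixes J :: "('v, 'k::field) mpoly set"
  assumes J: "ideal J poly_ring"
  shows "ideal (saturation J g) poly_ring"
  unfolding ideal_type_algebra_iff
proof (intro conjI ballI allI)
  show "0 \<in> saturation J g" using ideal_zero[OF J] by (simp add: saturation_def)
  fix a assume "a \<in> saturation J g"
  then obtain i where i: "g ^ i * a \<in> J" by (auto simp: saturation_def)
  show "r * a \<in> saturation J g" for r
    using ideal_mult[OF J i, of r] by (auto simp: saturation_def mult.left_commute)
  fix b assume "b \<in> saturation J g"
  then obtain j where j: "g ^ j * b \<in> J" by (auto simp: saturation_def)
  have "g ^ (i + j) * (a + b) = g ^ j * (g ^ i * a) + g ^ i * (g ^ j * b)"
    by (simp add: power_add algebra_simps)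
  moreover have "g ^ j * (g ^ i * a) + g ^ i * (g ^ j * b) \<in> J"
    by (intro ideal_add[OF J] ideal_mult[OF J] i j)
  ultimately have "g ^ (i + j) * (a + b) \<in> J" by (simp only:)
  then show "a + b \<in> saturation J g" unfolding saturation_def by blast
qed

text \<open>Modulo \<open>J\<close> the bases \<open>a + z\<close> and \<open>z\<close> agree, hence
  so do their powers.\<close>

lemma power_add_diff_mem:
  fixes J :: "'a::comm_ring_1 set"
  assumes J: "ideal J ring_of_type_algebra" and a: "a \<in> J"
  shows "(a + z) ^ n - z ^ n \<in> J"
proof (induction n)
  case 0
  then show ?case using ideal_zero[OF J] by simp
next
  case (Suc n)
  have "(a + z) ^ Suc n - z ^ Suc n = (a + z) * ((a + z) ^ n - z ^ n) + z ^ n * a"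
    by (simp add: algebra_simps)
  then show ?case using ideal_add[OF J ideal_mult[OF J Suc] ideal_mult[OF J a]] by simp
qed

section \<open>Orders that refine the exponent of y\<close>

abbreviation y_part :: "'v \<Rightarrow> nat \<Rightarrow> ('v, 'k::field) mpoly \<Rightarrow> ('v, 'k) mpoly"
  where "y_part y \<equiv> wpart (\<lambda>t. lookup t y)"

lemma y_part_single_mult:
  fixes p :: "('v, 'k::field) mpoly"
  shows "y_part y j (single t c * p) =
    (if lookup t y \<le> j then single t c * y_part y (j - lookup t y) p else 0)"
  by (rule wpart_single_mult) (simp add: lookup_add)

lemma y_part_0_var_mult:
  fixes p :: "('v, 'k::field) mpoly"
  shows "y_part y 0 (var y * p) = 0"
  by (simp add: var_def y_part_single_mult)

text \<open>Compatibility of the order with initial y-forms, expressed on monomials. The theorem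
  derives this form from its hypothesis on initial terms.\<close>

locale y_order = monomial_order prec for prec :: "'v::finite monomial \<Rightarrow> 'v monomial \<Rightarrow> bool" +
  fixes y :: 'v
  assumes prec_y: "prec s t \<Longrightarrow> lookup s y \<le> lookup t y"
begin

lemma lookup_y_le_lm: "s \<in> keys p \<Longrightarrow> lookup s y \<le> lookup (lm p) y"
  using prec_lm[of p s] prec_y[of s "lm p"] by (cases "s = lm p"; cases "p = 0") auto

lemma init_form_zero [simp]: "init_form y 0 = 0"
  by (simp add: init_form_def)

text \<open>The leading monomial has the highest exponent of \<open>y\<close> in \<open>p\<close>,
  so it selects the component that is the initial y-form.\<close>

lemma init_form_eq:
  assumes "p \<noteq> 0"
  shows "init_form y p = y_part y (lookup (lm p) y) p"
proof (rule poly_mapping_eqI)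
  fix u
  let ?A = "{t \<in> keys p. \<forall>s\<in>keys p. lookup s y \<le> lookup t y}"
  have A: "t \<in> ?A \<longleftrightarrow> t \<in> keys p \<and> lookup t y = lookup (lm p) y" for t
    using lm_in_keys[OF assms] lookup_y_le_lm[of _ p] by (auto intro: antisym)
  have "lookup (init_form y p) u = (\<Sum>t\<in>?A. if t = u then lookup p t else 0)"
    by (simp add: init_form_def lookup_sum lookup_single when_def)
  also have "\<dots> = (if u \<in> ?A then lookup p u else 0)" by (simp add: sum.delta)
  also have "\<dots> = lookup (y_part y (lookup (lm p) y) p) u"
    unfolding A by (auto simp: lookup_wpart when_def in_keys_iff)
  finally show "lookup (init_form y p) u = lookup (y_part y (lookup (lm p) y) p) u" .
qed

lemma
  assumes "p \<noteq> 0"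
  shows lm_init_form: "lm (init_form y p) = lm p" and init_form_nonzero: "init_form y p \<noteq> 0"
proof -
  have lm: "lm p \<in> keys (init_form y p)"
    using lm_in_keys[OF assms] by (simp add: init_form_eq[OF assms] keys_wpart)
  then show "init_form y p \<noteq> 0" by auto
  show "lm (init_form y p) = lm p"
    using prec_lm[OF assms] by (intro lm_eqI lm) (auto simp: init_form_eq[OF assms] keys_wpart)
qed

text \<open>Either no monomial of \<open>f\<close> has exponent \<open>j\<close>, and the component
  is 0, or \<open>j\<close> is the top exponent and the component is the initial y-form of
  \<open>f\<close>.\<close>

lemma y_part_top_mem_init_form_ideal:
  assumes "f \<in> I" and "\<And>s. s \<in> keys f \<Longrightarrow> lookup s y \<le> j"
  shows "y_part y j f \<in> init_form_ideal y I"
proof (cases "y_part y j f = 0")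
  case True
  then show ?thesis unfolding init_form_ideal_def by (simp add: ideal_zero[OF ideal_Idl])
next
  case False
  then obtain s where s: "s \<in> keys f" "lookup s y = j" by (auto simp: keys_wpart simp flip: keys_eq_empty)
  then have f: "f \<noteq> 0" by auto
  have "lookup (lm f) y = j"
    using lookup_y_le_lm[OF s(1)] s(2) assms(2)[OF lm_in_keys[OF f]] by simp
  then have "y_part y j f = init_form y f" using init_form_eq[OF f] by simp
  then show ?thesis
    unfolding init_form_ideal_def using Idl_superset[of "init_form y ` I"] assms(1) by auto
qed

text \<open>The polynomials with this property for every \<open>j\<close> form an ideal that
  contains the initial y-forms. The witness \<open>f\<close> may have exponents below
  \<open>j\<close> only, which accounts for vanishing components.\<close>

lemma init_form_ideal_y_part:
  fixes I :: "('v, 'k::field) mpoly set"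
  assumes I: "ideal I poly_ring" and h: "h \<in> init_form_ideal y I"
  shows "\<exists>f\<in>I. (\<forall>s\<in>keys f. lookup s y \<le> j) \<and> y_part y j f = y_part y j h"
proof -
  define T where "T = {h :: ('v, 'k) mpoly.
    \<forall>j. \<exists>f\<in>I. (\<forall>s\<in>keys f. lookup s y \<le> j) \<and> y_part y j f = y_part y j h}"
  have T_D: "\<exists>f\<in>I. (\<forall>s\<in>keys f. lookup s y \<le> j) \<and> y_part y j f = y_part y j h"
    if "h \<in> T" for h j
    using that unfolding T_def by blast
  have "ideal T poly_ring"
    unfolding ideal_mpoly_iff
  proof (intro conjI ballI allI)
    show "0 \<in> T" using ideal_zero[OF I] by (auto simp: T_def intro!: bexI[of _ 0])
  next
    fix a b assume ab: "a \<in> T" "b \<in> T"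
    have "\<exists>f\<in>I. (\<forall>s\<in>keys f. lookup s y \<le> j) \<and> y_part y j f = y_part y j (a + b)" for j
    proof -
      obtain f where f: "f \<in> I" "\<forall>s\<in>keys f. lookup s y \<le> j" "y_part y j f = y_part y j a"
        using T_D[OF ab(1)] by blast
      obtain g where g: "g \<in> I" "\<forall>s\<in>keys g. lookup s y \<le> j" "y_part y j g = y_part y j b"
        using T_D[OF ab(2)] by blast
      have "\<forall>s\<in>keys (f + g). lookup s y \<le> j" using keys_add[of f g] f(2) g(2) by blast
      then show ?thesis
        using ideal_add[OF I f(1) g(1)] f(3) g(3) by (auto simp: wpart_add intro!: bexI[of _ "f + g"])
    qed
    then show "a + b \<in> T" by (simp add: T_def)
  next
    fix a t and c :: 'k assume a: "a \<in> T"
    have "\<exists>f\<in>I. (\<forall>s\<in>keys f. lookup s y \<le> j) \<and> y_part y j f = y_part y j (single t c * a)" for j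
    \<comment> \<open>Components of the product below exponent \<open>lookup t y\<close> vanish, and
      0 is a witness. Otherwise the witness for \<open>j - lookup t y\<close> is multiplied by the
      term.\<close>
    proof (cases "c = 0 \<or> j < lookup t y")
      case True
      then show ?thesis
        using ideal_zero[OF I] by (auto simp: y_part_single_mult intro!: bexI[of _ 0])
    next
      case False
      obtain f where f: "f \<in> I" "\<forall>s\<in>keys f. lookup s y \<le> j - lookup t y"
        "y_part y (j - lookup t y) f = y_part y (j - lookup t y) a"
        using T_D[OF a] by blast
      have "\<forall>s\<in>keys (single t c * f). lookup s y \<le> j"
        using f(2) False by (auto simp: keys_single_mult lookup_add)
      moreover have "y_part y j (single t c * f) = y_part y j (single t c * a)"
        using f(3) by (simp add: y_part_single_mult)
      ultimately show ?thesis using ideal_mult[OF I f(1)] by blast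
    qed
    then show "single t c * a \<in> T" by (simp add: T_def)
  qed
  moreover have "init_form y ` I \<subseteq> T"
  proof (rule image_subsetI)
    fix f assume f: "f \<in> I"
    have "\<exists>g\<in>I. (\<forall>s\<in>keys g. lookup s y \<le> j) \<and> y_part y j g = y_part y j (init_form y f)" for j
    proof (cases "f \<noteq> 0 \<and> j = lookup (lm f) y")
      case True
      then have "y_part y j f = y_part y j (init_form y f)"
        using wpart_idem[of "y_part y j f" "\<lambda>t. lookup t y" j j] by (simp add: init_form_eq keys_wpart)
      then show ?thesis using f True lookup_y_le_lm by blast
    next
      case False
      then have "y_part y j (init_form y f) = 0"
        by (cases "f = 0")
          (simp, intro poly_mapping_eqI, auto simp: init_form_eq lookup_wpart when_def)
      then show ?thesis using ideal_zero[OF I] by (auto intro!: bexI[of _ 0])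
    qed
    then show "init_form y f \<in> T" by (simp add: T_def)
  qed
  ultimately have "init_form_ideal y I \<subseteq> T"
    unfolding init_form_ideal_def by (rule Idl_least)
  then show ?thesis using h T_D by blast
qed

text \<open>For \<open>h\<close> in the initial form ideal, some \<open>f\<close> in
  \<open>I\<close> shares its top y-component, so the initial y-forms and with them the leading
  monomials of \<open>f\<close> and \<open>h\<close> agree. Conversely, passing to the initial
  y-form keeps the leading monomial.\<close>

lemma leads_init_form_ideal:
  fixes I :: "('v, 'k::field) mpoly set"
  assumes I: "ideal I poly_ring"
  shows "leads (init_form_ideal y I) = leads I"
proof
  have "lm h \<in> leads I" if h: "h \<in> init_form_ideal y I" "h \<noteq> 0" for h
  proof -
    let ?j = "lookup (lm h) y"
    obtain f where f: "f \<in> I" "\<forall>s\<in>keys f. lookup s y \<le> ?j" "y_part y ?j f = y_part y ?j h"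
      using init_form_ideal_y_part[OF I h(1)] by blast
    have "y_part y ?j f = init_form y h" using f(3) init_form_eq[OF h(2)] by simp
    then have "lm h \<in> keys (y_part y ?j f)"
      using lm_in_keys[OF init_form_nonzero[OF h(2)]] lm_init_form[OF h(2)] by simp
    then have lm: "lm h \<in> keys f" by (simp add: keys_wpart)
    then have "f \<noteq> 0" by auto
    have "lookup (lm f) y = ?j"
      using f(2) lookup_y_le_lm[OF lm] lm_in_keys[OF \<open>f \<noteq> 0\<close>] by (simp add: antisym)
    then have "init_form y f = init_form y h"
      using f(3) by (simp add: init_form_eq \<open>f \<noteq> 0\<close> h(2))
    then have "lm f = lm h" using lm_init_form \<open>f \<noteq> 0\<close> h(2) by metis
    then show ?thesis using lm_in_leads[OF f(1) \<open>f \<noteq> 0\<close>] by simp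
  qed
  then show "leads (init_form_ideal y I) \<subseteq> leads I"
    by (intro leads_subset_if) (simp_all add: init_form_ideal_def ideal_Idl)
  have "lm f \<in> leads (init_form_ideal y I)" if f: "f \<in> I" "f \<noteq> 0" for f
  proof -
    have "init_form y f \<in> init_form_ideal y I"
      unfolding init_form_ideal_def using f(1) by (intro subsetD[OF Idl_superset] imageI)
    then have "lm (init_form y f) \<in> leads (init_form_ideal y I)"
      using init_form_nonzero[OF f(2)] by (rule lm_in_leads)
    then show ?thesis using lm_init_form[OF f(2)] by simp
  qed
  then show "leads I \<subseteq> leads (init_form_ideal y I)"
    by (intro leads_subset_if I)
qed

text \<open>The initial $y$-form of a degree component of \<open>f\<close> is that component of the initial
  $y$-form of \<open>f\<close>, unless the latter vanishes.\<close>

lemma init_form_ideal_homogeneous: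
  fixes I :: "('v, 'k::field) mpoly set"
  assumes I: "\<And>f k. f \<in> I \<Longrightarrow> wpart mono_degree k f \<in> I" and h: "h \<in> init_form_ideal y I"
  shows "wpart mono_degree k h \<in> init_form_ideal y I"
proof -
  have "wpart mono_degree k (init_form y f) \<in> init_form_ideal y I" if f: "f \<in> I" for f k
  proof (cases "f = 0")
    case True
    then show ?thesis unfolding init_form_ideal_def by (simp add: ideal_zero[OF ideal_Idl])
  next
    case False
    have "wpart mono_degree k (init_form y f) = y_part y (lookup (lm f) y) (wpart mono_degree k f)"
      by (simp only: init_form_eq[OF False] wpart_commute[of mono_degree])
    then show ?thesis
      using y_part_top_mem_init_form_ideal[OF I[OF f], of k "lookup (lm f) y"] lookup_y_le_lm[of _ f]
      by (simp add: keys_wpart)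
  qed
  then show ?thesis
    using wpart_mem_Idl[where w = mono_degree and S = "init_form y ` I" and f = h and j = k,
        OF mono_degree_add] h
    unfolding init_form_ideal_def by blast
qed

end

subsection \<open>Geometric vertex decomposition\<close>

locale initial_y_forms = y_order prec y for prec :: "'v::finite monomial \<Rightarrow> 'v monomial \<Rightarrow> bool" and y +
  fixes I :: "('v, 'k::field) mpoly set" and A :: "'i set" and d :: "'i \<Rightarrow> nat"
    and q r :: "'i \<Rightarrow> ('v, 'k) mpoly"
  assumes I: "ideal I poly_ring"
    and finite_A: "finite A"
    and basis: "groebner_basis prec ((\<lambda>i. var y ^ d i * q i + r i) ` A) I"
    and form: "i \<in> A \<Longrightarrow> init_form y (var y ^ d i * q i + r i) = var y ^ d i * q i"
    and ndvd: "i \<in> A \<Longrightarrow> \<not> var y dvd q i"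
begin

definition I' where "I' = Idl\<^bsub>poly_ring\<^esub> ((\<lambda>i. var y ^ d i * q i) ` A)"
definition C where "C = Idl\<^bsub>poly_ring\<^esub> (q ` A)"
text \<open>The part of \<open>P\<close> before \<open>y\<close> is adjoined. It lies in
  \<open>I'\<close> and in \<open>C\<close> as well, which links the three ideals.\<close>

definition P0 where "P0 = Idl\<^bsub>poly_ring\<^esub> (q ` {i \<in> A. d i = 0})"
definition P where "P = P0 <+>\<^bsub>poly_ring\<^esub> Idl\<^bsub>poly_ring\<^esub> {var y}"

lemma ideal_I': "ideal I' poly_ring" and ideal_C: "ideal C poly_ring"
  and ideal_P0: "ideal P0 poly_ring" and ideal_P: "ideal P poly_ring"
  by (simp_all only: I'_def C_def P0_def P_def ideal_Idl ideal_set_add)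

lemma mem_P_iff: "f \<in> P \<longleftrightarrow> (\<exists>a\<in>P0. \<exists>b. f = a + var y * b)"
  by (auto simp: P_def Idl_singleton)

lemma P0_subset_P: "P0 \<subseteq> P"
proof
  fix a assume "a \<in> P0"
  moreover have "a = a + var y * 0" by simp
  ultimately show "a \<in> P" unfolding mem_P_iff by blast
qed

lemma var_mult_mem_P: "var y * b \<in> P"
  using ideal_zero[OF ideal_P0] unfolding mem_P_iff by (auto intro!: bexI[of _ 0])

lemma gen_mem_I': "i \<in> A \<Longrightarrow> var y ^ d i * q i \<in> I'"
  unfolding I'_def by (rule subsetD[OF Idl_superset]) blast

lemma gen_mem_C: "i \<in> A \<Longrightarrow> q i \<in> C"
  unfolding C_def by (rule subsetD[OF Idl_superset]) blast

lemma gen_mem_P0: "i \<in> A \<Longrightarrow> d i = 0 \<Longrightarrow> q i \<in> P0"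
  unfolding P0_def by (rule subsetD[OF Idl_superset]) blast

lemma P0_subset_I': "P0 \<subseteq> I'"
  unfolding P0_def using gen_mem_I' by (intro Idl_least[OF ideal_I']) force

lemma P0_subset_C: "P0 \<subseteq> C"
  unfolding P0_def using gen_mem_C by (intro Idl_least[OF ideal_C]) auto

lemma I'_subset: "I' \<subseteq> C \<inter> P"
  unfolding I'_def
proof (intro Idl_least ideal_Int ideal_C ideal_P image_subsetI IntI)
  fix i assume i: "i \<in> A"
  then show "var y ^ d i * q i \<in> C" by (intro ideal_mult[OF ideal_C] gen_mem_C)
  show "var y ^ d i * q i \<in> P"
  proof (cases "d i")
    case 0
    then show ?thesis using gen_mem_P0[OF i] P0_subset_P by auto
  next
    case (Suc n)
    then show ?thesis using var_mult_mem_P by (simp add: mult.assoc)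
  qed
qed

lemma q_nonzero: "i \<in> A \<Longrightarrow> q i \<noteq> 0"
  using ndvd[of i] by (metis dvd_0_right)

lemma var_power_mult_nonzero: "p \<noteq> 0 \<Longrightarrow> var y ^ n * p \<noteq> (0 :: ('v, 'k) mpoly)"
  by (simp add: var_power_eq single_mult_nonzero)

lemma lm_var_power_mult: "p \<noteq> 0 \<Longrightarrow> lm (var y ^ n * p :: ('v, 'k) mpoly) = single y n + lm p"
  by (simp add: var_power_eq lm_single_mult)

lemma basis_nonzero:
  assumes "i \<in> A"
  shows "var y ^ d i * q i + r i \<noteq> 0"
  using form[OF assms] var_power_mult_nonzero[OF q_nonzero[OF assms], of "d i"] by auto

lemma lm_basis:
  assumes "i \<in> A"
  shows "lm (var y ^ d i * q i + r i) = single y (d i) + lm (q i)"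
  using lm_init_form[OF basis_nonzero[OF assms]] form[OF assms]
  by (simp add: lm_var_power_mult q_nonzero assms)

text \<open>All monomials of the initial y-form \<open>var y ^ d i * q i\<close> have the same
  exponent of \<open>y\<close>, hence so do those of \<open>q i\<close>. As \<open>var y\<close>
  does not divide \<open>q i\<close>, that exponent is 0.\<close>

lemma q_y_free:
  assumes i: "i \<in> A" and t: "t \<in> keys (q i)"
  shows "lookup t y = 0"
proof -
  let ?p = "var y ^ d i * q i + r i"
  have top: "lookup s y + d i = lookup (lm ?p) y" if "s \<in> keys (q i)" for s
  proof -
    have "single y (d i) + s \<in> keys (init_form y ?p)"
      using that unfolding form[OF i] by (simp add: var_power_eq keys_single_mult)
    then show ?thesis
      by (simp add: init_form_eq[OF basis_nonzero[OF i]] keys_wpart lookup_add)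
  qed
  have "\<exists>s\<in>keys (q i). lookup s y = 0"
    using var_dvdI[of "q i" y] ndvd[OF i] by (metis gr0I)
  then obtain s where "s \<in> keys (q i)" "lookup s y = 0" ..
  then show ?thesis using top[of s] top[OF t] by simp
qed

lemma lm_q_y_free: "i \<in> A \<Longrightarrow> lookup (lm (q i)) y = 0"
  using q_y_free lm_in_keys q_nonzero by blast

lemma y_part_q: "i \<in> A \<Longrightarrow> y_part y j (q i) = (if j = 0 then q i else 0)"
  by (rule wpart_idem) (rule q_y_free)

text \<open>Generators free of \<open>y\<close> are homogeneous for the grading by the exponent of
  \<open>y\<close>, so the ideal is too.\<close>

lemma y_part_Idl_q:
  assumes "B \<subseteq> A" "f \<in> Idl\<^bsub>poly_ring\<^esub> (q ` B)"
  shows "y_part y j f \<in> Idl\<^bsub>poly_ring\<^esub> (q ` B)"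
proof (rule wpart_mem_Idl[OF _ _ assms(2)])
  fix s j assume s: "s \<in> q ` B"
  then have "y_part y j s = (if j = 0 then s else 0)" using assms(1) y_part_q by auto
  then show "y_part y j s \<in> Idl\<^bsub>poly_ring\<^esub> (q ` B)"
    using s subsetD[OF Idl_superset s] ideal_zero[OF ideal_Idl] by auto
qed (simp add: lookup_add)

lemma y_part_eq_self:
  assumes "lookup (lm f) y = 0"
  shows "y_part y 0 f = f"
  using wpart_idem[of f "\<lambda>t. lookup t y" 0 0] lookup_y_le_lm[of _ f] assms by simp

section \<open>Groebner bases of I', C and P\<close>

lemma leads_gen_iff:
  assumes "B \<subseteq> A"
  shows "t \<in> leads ((\<lambda>i. var y ^ d i * q i) ` B) \<longleftrightarrow> (\<exists>i\<in>B. \<exists>u. t = single y (d i) + lm (q i) + u)"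
  using assms q_nonzero
  by (intro leads_image_iff var_power_mult_nonzero lm_var_power_mult) auto

lemma leads_q_iff:
  assumes "B \<subseteq> A"
  shows "t \<in> leads (q ` B) \<longleftrightarrow> (\<exists>i\<in>B. \<exists>u. t = lm (q i) + u)"
  using assms q_nonzero by (intro leads_image_iff) auto

lemma leads_I_iff: "t \<in> leads I \<longleftrightarrow> (\<exists>i\<in>A. \<exists>u. t = single y (d i) + lm (q i) + u)"
  using leads_groebner_basis[OF basis]
    leads_image_iff[of A "\<lambda>i. var y ^ d i * q i + r i"] basis_nonzero lm_basis by simp

lemma I'_subset_init_form_ideal: "I' \<subseteq> init_form_ideal y I"
proof -
  have "(\<lambda>i. var y ^ d i * q i) ` A \<subseteq> init_form_ideal y I"
  proof (rule image_subsetI)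
    fix i assume i: "i \<in> A"
    have "init_form y (var y ^ d i * q i + r i) \<in> init_form_ideal y I"
      using basis i unfolding groebner_basis_iff init_form_ideal_def
      by (intro subsetD[OF Idl_superset]) blast
    then show "var y ^ d i * q i \<in> init_form_ideal y I" using form[OF i] by simp
  qed
  then show ?thesis
    unfolding I'_def by (intro Idl_least) (simp_all add: init_form_ideal_def ideal_Idl)
qed

lemma groebner_I': "groebner_basis prec ((\<lambda>i. var y ^ d i * q i) ` A) I'"
  and I'_eq: "I' = init_form_ideal y I"
proof -
  let ?G = "(\<lambda>i. var y ^ d i * q i) ` A"
  have J: "ideal (init_form_ideal y I) poly_ring" by (simp add: init_form_ideal_def ideal_Idl)
  have G: "?G \<subseteq> init_form_ideal y I"
    using gen_mem_I' I'_subset_init_form_ideal by blast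
  \<comment> \<open>Both sides consist of the multiples of the
    \<open>single y (d i) + lm (q i)\<close>, since the \<open>r i\<close> do not affect leading
    monomials.\<close>
  have leads: "leads (init_form_ideal y I) \<subseteq> leads ?G"
    by (simp add: leads_init_form_ideal[OF I] subset_iff leads_I_iff leads_gen_iff)
  show I': "I' = init_form_ideal y I"
    unfolding I'_def using Idl_groebner_basis[OF J _ G leads] finite_A by simp
  show "groebner_basis prec ?G I'"
    unfolding I' using groebner_basisI[OF J _ G leads] finite_A by simp
qed

lemma leads_I': "leads I' = leads I"
  by (simp add: I'_eq leads_init_form_ideal[OF I])

lemma groebner_C: "groebner_basis prec (q ` A) C"
  and C_eq_saturation: "C = saturation I' (var y)"
proof -
  let ?S = "saturation I' (var y)"
  have S: "ideal ?S poly_ring" by (rule ideal_saturation[OF ideal_I'])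
  have G: "q ` A \<subseteq> ?S" using gen_mem_I' by (auto simp: saturation_def)
  have leads: "leads ?S \<subseteq> leads (q ` A)"
  proof (rule leads_subset_if[OF S])
    fix f assume f: "f \<in> ?S" "f \<noteq> 0"
    then obtain j where "var y ^ j * f \<in> I'" by (auto simp: saturation_def)
    then have "lm (var y ^ j * f) \<in> leads I'"
      using var_power_mult_nonzero[OF f(2)] by (intro lm_in_leads)
    then obtain i u where i: "i \<in> A" and u: "single y j + lm f = single y (d i) + lm (q i) + u"
      unfolding leads_I' leads_I_iff lm_var_power_mult[OF f(2)] by blast
    \<comment> \<open>As \<open>lm (q i)\<close> is free of \<open>y\<close>, the powers of
      \<open>y\<close> on both sides can be discarded.\<close>
    have "\<exists>w. lm f = lm (q i) + w"
      by (rule monomial_cancel_var[OF u lm_q_y_free[OF i]])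
    then show "lm f \<in> leads (q ` A)" using i by (auto simp: leads_q_iff)
  qed
  show C: "C = ?S"
    unfolding C_def using Idl_groebner_basis[OF S _ G leads] finite_A by simp
  show "groebner_basis prec (q ` A) C"
    unfolding C using groebner_basisI[OF S _ G leads] finite_A by simp
qed

lemma lm_var: "lm (var y :: ('v, 'k) mpoly) = single y 1" and var_nonzero: "var y \<noteq> (0 :: ('v, 'k) mpoly)"
  using lm_var_power_mult[of 1 1] var_power_mult_nonzero[of 1 1] lm_eqI[of 0 "1 :: ('v, 'k) mpoly"]
  by simp_all

lemma groebner_P: "groebner_basis prec (q ` {i \<in> A. d i = 0} \<union> {var y}) P"
proof (rule groebner_basisI[OF ideal_P])
  show "finite (q ` {i \<in> A. d i = 0} \<union> {var y})" using finite_A by simp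
  show "q ` {i \<in> A. d i = 0} \<union> {var y} \<subseteq> P"
    using gen_mem_P0 P0_subset_P var_mult_mem_P[of 1] by auto
  show "leads P \<subseteq> leads (q ` {i \<in> A. d i = 0} \<union> {var y})"
  proof (rule leads_subset_if[OF ideal_P])
    fix f assume f: "f \<in> P" "f \<noteq> 0"
    show "lm f \<in> leads (q ` {i \<in> A. d i = 0} \<union> {var y})"
    proof (cases "lookup (lm f) y = 0")
      case True
      obtain a b where ab: "a \<in> P0" "f = a + var y * b" using f(1) unfolding mem_P_iff by blast
      \<comment> \<open>The leading monomial bounds the exponents of \<open>y\<close>, so all of
        \<open>f\<close> is free of \<open>y\<close> and equals its component of exponent 0, to
        which \<open>var y * b\<close> contributes nothing. This places \<open>f\<close> in
        \<open>I'\<close>, whose leading monomials are known.\<close>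
      have "f = y_part y 0 a"
        using y_part_eq_self[OF True] ab(2) by (simp add: wpart_add y_part_0_var_mult)
      then have "f \<in> I'"
        using y_part_Idl_q[of "{i \<in> A. d i = 0}" a 0] ab(1) P0_subset_I' by (auto simp: P0_def)
      then have "lm f \<in> leads I" using f(2) lm_in_leads leads_I' by blast
      then obtain i u where i: "i \<in> A" "lm f = single y (d i) + lm (q i) + u"
        unfolding leads_I_iff by blast
      then have "d i = 0" using True by (simp add: lookup_add)
      then have "lm f \<in> leads (q ` {i \<in> A. d i = 0})" using i by (auto simp: leads_q_iff)
      then show ?thesis using leads_mono[of "q ` {i \<in> A. d i = 0}"] by blast
    next
      case False
      then obtain u where "lm f = single y 1 + u" using monomial_split_var[of 1 "lm f" y] by auto
      then have "lm f \<in> leads {var y :: ('v, 'k) mpoly}"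
        using lm_var var_nonzero by (simp add: leads_def)
      then show ?thesis using leads_mono[of "{var y :: ('v, 'k) mpoly}"] by blast
    qed
  qed
qed

lemma leads_C_iff: "t \<in> leads C \<longleftrightarrow> (\<exists>i\<in>A. \<exists>u. t = lm (q i) + u)"
  by (simp add: leads_groebner_basis[OF groebner_C] leads_q_iff)

lemma leads_P_iff:
  "t \<in> leads P \<longleftrightarrow> lookup t y \<noteq> 0 \<or> (\<exists>i\<in>A. d i = 0 \<and> (\<exists>u. t = lm (q i) + u))"
proof -
  have "t \<in> leads {var y :: ('v, 'k) mpoly} \<longleftrightarrow> (\<exists>u. t = single y 1 + u)"
    using lm_var var_nonzero by (simp add: leads_def)
  also have "\<dots> \<longleftrightarrow> lookup t y \<noteq> 0"
  proof
    assume "lookup t y \<noteq> 0"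
    then have "1 \<le> lookup t y" by simp
    from monomial_split_var[OF this] show "\<exists>u. t = single y 1 + u" by blast
  qed (auto simp: lookup_add)
  finally show ?thesis
    unfolding leads_groebner_basis[OF groebner_P] leads_Un by (auto simp: leads_q_iff)
qed

section \<open>Intersection and sum of C and P\<close>

lemma leads_I_y_free_iff:
  assumes "lookup t y = 0"
  shows "t \<in> leads I \<longleftrightarrow> t \<in> leads P"
proof -
  \<comment> \<open>A generator with positive \<open>d i\<close> has a leading monomial divisible by
    \<open>y\<close>, which cannot divide \<open>t\<close>.\<close>
  have "d i = 0" if "t = single y (d i) + lm (q i) + u" for i u
    using assms unfolding that by (simp add: lookup_add)
  then have "t \<in> leads I \<longleftrightarrow> (\<exists>i\<in>A. \<exists>u. d i = 0 \<and> t = single y (d i) + lm (q i) + u)"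
    unfolding leads_I_iff by blast
  also have "\<dots> \<longleftrightarrow> (\<exists>i\<in>A. d i = 0 \<and> (\<exists>u. t = lm (q i) + u))"
    by auto
  finally show ?thesis using assms by (simp add: leads_P_iff)
qed

text \<open>The monomials \<open>lm (q i)\<close> generating \<open>leads C\<close> are free of
  \<open>y\<close>, so a power of \<open>y\<close> does not help divisibility by them.\<close>

lemma leads_C_if_y_shift:
  assumes "single y n + u \<in> leads C"
  shows "u \<in> leads C"
proof -
  obtain i w where i: "i \<in> A" "single y n + u = lm (q i) + w"
    using assms unfolding leads_C_iff by blast
  have "\<exists>w. u = lm (q i) + w"
    using monomial_cancel_var[of y n u 0 "lm (q i)" w] i lm_q_y_free by simp
  then show ?thesis using i(1) unfolding leads_C_iff by blast
qed

lemma leads_I_subset_C: "leads I \<subseteq> leads C"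
  using leads_mono[of I' C] I'_subset leads_I' by simp

text \<open>Given equality, \<open>var y * q i\<close> lies in \<open>C\<close> and in
  \<open>P\<close>, hence in \<open>I'\<close>, and its leading monomial gives the shift.
  Conversely, a leading monomial of the intersection is either free of \<open>y\<close>, where
  \<open>leads P\<close> and \<open>leads I\<close> agree, or \<open>y\<close> times an element of
  \<open>leads C\<close>.\<close>

lemma I'_eq_Int_iff:
  "I' = C \<inter> P \<longleftrightarrow> (\<forall>u\<in>leads C. single y 1 + u \<in> leads I)"
proof
  assume eq: "I' = C \<inter> P"
  show "\<forall>u\<in>leads C. single y 1 + u \<in> leads I"
  proof
    fix u assume "u \<in> leads C"
    then obtain i w where i: "i \<in> A" "u = lm (q i) + w" unfolding leads_C_iff by blast
    have "var y * q i \<in> I'"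
      unfolding eq using i(1) var_mult_mem_P ideal_mult[OF ideal_C gen_mem_C] by blast
    then have "lm (var y ^ 1 * q i) \<in> leads I'"
      using var_power_mult_nonzero[OF q_nonzero[OF i(1)], of 1] by (intro lm_in_leads) simp_all
    then have "w + (single y 1 + lm (q i)) \<in> leads I"
      unfolding leads_I' lm_var_power_mult[OF q_nonzero[OF i(1)]] by (rule leads_add)
    then show "single y 1 + u \<in> leads I" unfolding i(2) by (simp add: add_ac)
  qed
next
  assume shift: "\<forall>u\<in>leads C. single y 1 + u \<in> leads I"
  have "t \<in> leads I" if t: "t \<in> leads (C \<inter> P)" for t
  proof (cases "lookup t y = 0")
    case True
    then show ?thesis
      using t leads_mono[of "C \<inter> P" P] by (auto simp: leads_I_y_free_iff)
  next
    case False
    then obtain u where u: "t = single y 1 + u" using monomial_split_var[of 1 t y] by auto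
    then have "u \<in> leads C"
      using t leads_mono[of "C \<inter> P" C] leads_C_if_y_shift[of 1 u] by auto
    then show ?thesis using shift u by blast
  qed
  then show "I' = C \<inter> P"
    using I'_subset leads_I' by (intro ideal_eq_if_leads ideal_I' ideal_Int ideal_C ideal_P) auto
qed

lemma I'_eq_Int:
  assumes "\<And>i. i \<in> A \<Longrightarrow> d i \<le> 1"
  shows "I' = C \<inter> P"
  unfolding I'_eq_Int_iff
proof
  fix u assume "u \<in> leads C"
  then obtain i w where i: "i \<in> A" "u = lm (q i) + w" unfolding leads_C_iff by blast
  \<comment> \<open>The exponent \<open>1 - d i\<close> supplies the factor \<open>y\<close> that is
    missing when \<open>d i = 0\<close>.\<close>
  have "single y (1 :: nat) = single y (d i) + single y (1 - d i)"
    using assms[OF i(1)] by (simp flip: single_add)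
  then have "single y 1 + u = single y (d i) + lm (q i) + (single y (1 - d i) + w)"
    unfolding i(2) by (simp add: add_ac)
  then show "single y 1 + u \<in> leads I" unfolding leads_I_iff using i(1) by blast
qed

text \<open>A leading monomial divisible by \<open>y\<close> lies in \<open>leads P\<close>. If it
  is free of \<open>y\<close>, so is \<open>f\<close>, and taking the component of exponent 0 drops
  the multiple of \<open>y\<close> and stays in \<open>C\<close>, because
  \<open>P0 \<subseteq> C\<close>.\<close>

lemma leads_C_plus_P: "leads (C <+>\<^bsub>poly_ring\<^esub> P) \<subseteq> leads C \<union> leads P"
proof
  fix t assume "t \<in> leads (C <+>\<^bsub>poly_ring\<^esub> P)"
  then obtain f where f: "f \<in> C <+>\<^bsub>poly_ring\<^esub> P" "f \<noteq> 0" "lm f = t"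
    by (rule leads_ideal[OF ideal_set_add[OF ideal_C ideal_P]])
  obtain c a b where cab: "c \<in> C" "a \<in> P0" "f = c + (a + var y * b)"
    using f(1) mem_P_iff by auto
  have "t \<in> leads C" if y: "lookup t y = 0"
  proof -
    have "c + a \<in> C" using ideal_add[OF ideal_C cab(1)] cab(2) P0_subset_C by blast
    then have "y_part y 0 (c + a) \<in> C" using y_part_Idl_q[of A] unfolding C_def by simp
    moreover have "f = y_part y 0 (c + a)"
      using y_part_eq_self[of f] y f(3) cab(3) by (simp add: wpart_add y_part_0_var_mult)
    ultimately show ?thesis using lm_in_leads[of f C] f by simp
  qed
  then show "t \<in> leads C \<union> leads P" using leads_P_iff by blast
qed

text \<open>A monomial in a sum of monomial ideals lies in one of the summands, so the comparison of
  leading monomials carries over term by term.\<close>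

lemma init_ideal_C_plus_P:
  "init_ideal prec (C <+>\<^bsub>poly_ring\<^esub> P) =
    init_ideal prec C <+>\<^bsub>poly_ring\<^esub> init_ideal prec P" (is "?L = ?R")
proof
  have ideals: "ideal (init_ideal prec J) poly_ring" for J :: "('v, 'k) mpoly set"
    by (simp add: init_ideal_def ideal_Idl)
  have CR: "init_ideal prec C \<subseteq> ?R" and PR: "init_ideal prec P \<subseteq> ?R"
    using ideal_zero[OF ideals] by (force, force)
  show "?L \<subseteq> ?R"
  proof
    fix p assume p: "p \<in> ?L"
    have "(\<Sum>t\<in>keys p. single t (lookup p t)) \<in> ?R"
    proof (rule ideal_sum[OF ideal_set_add[OF ideals ideals]])
      fix t assume "t \<in> keys p"
      then have "t \<in> leads C \<union> leads P" using p leads_C_plus_P by (auto simp: init_ideal_eq)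
      then have "single t (lookup p t) \<in> init_ideal prec C \<union> init_ideal prec P"
        by (auto simp: init_ideal_eq)
      then show "single t (lookup p t) \<in> ?R" using CR PR by blast
    qed
    then show "p \<in> ?R" by (simp only: sum_singles)
  qed
  have "C \<subseteq> C <+>\<^bsub>poly_ring\<^esub> P" "P \<subseteq> C <+>\<^bsub>poly_ring\<^esub> P"
    using ideal_zero[OF ideal_C] ideal_zero[OF ideal_P] by (force, force)
  then have "leads C \<union> leads P \<subseteq> leads (C <+>\<^bsub>poly_ring\<^esub> P)"
    using leads_mono by blast
  then show "?R \<subseteq> ?L"
  proof (intro subsetI)
    fix p assume sub: "leads C \<union> leads P \<subseteq> leads (C <+>\<^bsub>poly_ring\<^esub> P)" and "p \<in> ?R"
    then obtain a b where "p = a + b" "keys a \<subseteq> leads C" "keys b \<subseteq> leads P"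
      by (auto simp: init_ideal_eq)
    then show "p \<in> ?L" using keys_add[of a b] sub unfolding init_ideal_eq by blast
  qed
qed

section \<open>Radicals\<close>

lemma radical_I': "ideal_radical I' = ideal_radical C \<inter> ideal_radical P"
proof
  show "ideal_radical I' \<subseteq> ideal_radical C \<inter> ideal_radical P"
    using I'_subset by (auto simp: ideal_radical_def)
  show "ideal_radical C \<inter> ideal_radical P \<subseteq> ideal_radical I'"
  proof
    fix f assume "f \<in> ideal_radical C \<inter> ideal_radical P"
    then obtain k l where k: "k \<ge> 1" "f ^ k \<in> C" and l: "f ^ l \<in> P"
      by (auto simp: ideal_radical_def)
    obtain j where j: "var y ^ j * f ^ k \<in> I'"
      using k(2) unfolding C_eq_saturation by (auto simp: saturation_def)
    obtain a b where ab: "a \<in> P0" "f ^ l = a + var y * b" using l unfolding mem_P_iff by blast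
    \<comment> \<open>Modulo \<open>P0\<close> the power \<open>f ^ l\<close> is
      \<open>var y * b\<close>, so its \<open>j\<close>-th power provides the factor
      \<open>var y ^ j\<close> that carries \<open>f ^ k\<close> into \<open>I'\<close>. The bound
      \<open>k \<ge> 1\<close> keeps the exponent positive even if \<open>l * j = 0\<close>.\<close>
    have "f ^ (k + l * j) = f ^ k * (a + var y * b) ^ j"
      by (simp only: power_add power_mult ab(2))
    also have "\<dots> = f ^ k * ((a + var y * b) ^ j - (var y * b) ^ j) + b ^ j * (var y ^ j * f ^ k)"
      by (simp add: power_mult_distrib algebra_simps)
    also have "\<dots> \<in> I'"
      using ab(1) P0_subset_I'
      by (intro ideal_add[OF ideal_I'] ideal_mult[OF ideal_I'] j power_add_diff_mem ideal_I') blast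
    finally show "f \<in> ideal_radical I'"
      using k(1) unfolding ideal_radical_def by (auto intro!: exI[of _ "k + l * j"])
  qed
qed

section \<open>Counting standard monomials\<close>

text \<open>Degree 0 is set apart because \<open>k - 1\<close> is truncated: otherwise
  \<open>y\<close> could be listed among the monomials of degree 0.\<close>

lemma standard_subset:
  "standard P k \<union> (if k = 0 then {} else (+) (single y 1) ` standard C (k - 1)) \<subseteq> standard I k"
  (is "_ \<union> ?Y \<subseteq> _")
proof -
  have "standard P k \<subseteq> standard I k"
  proof
    fix t assume t: "t \<in> standard P k"
    then have "lookup t y = 0" by (auto simp: standard_def leads_P_iff)
    then show "t \<in> standard I k" using t by (simp add: standard_def leads_I_y_free_iff)
  qed
  \<comment> \<open>If \<open>y\<close> times a monomial were in \<open>leads I\<close>, it would be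
    in \<open>leads C\<close>, and removing \<open>y\<close> would put the monomial itself
    there.\<close>
  moreover have "?Y \<subseteq> standard I k"
  proof (cases k)
    case (Suc n)
    then show ?thesis
      using leads_I_subset_C leads_C_if_y_shift[of 1]
      by (auto simp: standard_def mono_degree_add mono_degree_single)
  qed simp
  ultimately show ?thesis by simp
qed

text \<open>Monomials standard for \<open>P\<close> are free of \<open>y\<close>, so the union is
  disjoint; multiplication by \<open>y\<close> is injective.\<close>

lemma card_standard:
  "card (standard P k \<union> (if k = 0 then {} else (+) (single y 1) ` standard C (k - 1))) =
    card (standard P k) + (if k = 0 then 0 else card (standard C (k - 1)))"
proof -
  have "standard P k \<inter> (+) (single y 1) ` standard C (k - 1) = {}"
    by (auto simp: standard_def leads_P_iff lookup_add)
  moreover have "card ((+) (single y (1::nat)) ` B) = card B" for B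
    by (rule card_image) (simp add: inj_on_def)
  ultimately show ?thesis by (simp add: card_Un_disjoint finite_standard)
qed

text \<open>A monomial \<open>y u\<close> standard for \<open>I\<close> is covered exactly if
  \<open>u\<close> is standard for \<open>C\<close>. Over all degrees this says that
  \<open>y\<close> times \<open>leads C\<close> lies in \<open>leads I\<close>.\<close>

lemma standard_eq_iff:
  "(\<forall>k. standard I k \<subseteq> standard P k \<union> (if k = 0 then {} else (+) (single y 1) ` standard C (k - 1)))
    \<longleftrightarrow> I' = C \<inter> P"
  unfolding I'_eq_Int_iff
proof
  assume sub: "\<forall>k. standard I k \<subseteq>
    standard P k \<union> (if k = 0 then {} else (+) (single y 1) ` standard C (k - 1))"
  show "\<forall>u\<in>leads C. single y 1 + u \<in> leads I"
  proof (rule ccontr)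
    assume "\<not> ?thesis"
    then obtain u where u: "u \<in> leads C" "single y 1 + u \<notin> leads I" by blast
    let ?k = "mono_degree (single y 1 + u)"
    have "single y 1 + u \<in> standard I ?k" using u(2) by (simp add: standard_def)
    then have "single y 1 + u \<in>
        standard P ?k \<union> (if ?k = 0 then {} else (+) (single y 1) ` standard C (?k - 1))"
      using sub by blast
    moreover have "single y 1 + u \<notin> standard P k" for k
      by (simp add: standard_def leads_P_iff lookup_add)
    moreover have "single y 1 + u \<notin> (+) (single y 1) ` standard C k" for k
      using u(1) by (auto simp: standard_def)
    ultimately show False by (simp only: Un_iff split: if_splits) simp_all
  qed
next
  assume shift: "\<forall>u\<in>leads C. single y 1 + u \<in> leads I"
  show "\<forall>k. standard I k \<subseteq>
    standard P k \<union> (if k = 0 then {} else (+) (single y 1) ` standard C (k - 1))"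
  proof (intro allI subsetI)
    fix k t assume t: "t \<in> standard I k"
    show "t \<in> standard P k \<union> (if k = 0 then {} else (+) (single y 1) ` standard C (k - 1))"
    proof (cases "lookup t y = 0")
      case True
      then show ?thesis using t by (simp add: standard_def leads_I_y_free_iff)
    next
      case False
      then obtain u where u: "t = single y 1 + u" using monomial_split_var[of 1 t y] by auto
      have "k = Suc (mono_degree u)"
        using t u by (simp add: standard_def mono_degree_add mono_degree_single)
      moreover have "u \<in> standard C (mono_degree u)" using t u shift by (auto simp: standard_def)
      ultimately show ?thesis using u by auto
    qed
  qed
qed

text \<open>Homogeneity passes from \<open>I\<close> to \<open>I'\<close>, and from there to
  \<open>C\<close> and \<open>P\<close>. Then all coefficients count standard monomials, and both
  claims concern inclusions of finite sets.\<close>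

lemma hilbert_series_bound:
  assumes hom: "homogeneous_ideal I"
  shows "fps_nth (hilbert_series I) k \<ge> fps_nth (hilbert_series P + fps_X * hilbert_series C) k"
    and "hilbert_series I = hilbert_series P + fps_X * hilbert_series C \<longleftrightarrow> I' = C \<inter> P"
proof -
  let ?B = "\<lambda>k. standard P k \<union> (if k = 0 then {} else (+) (single y 1) ` standard C (k - 1))"
  have hom_I: "wpart mono_degree k f \<in> I" if "f \<in> I" for f k
    using homogeneous_ideal_wpart[OF hom that] .
  have hom_I': "wpart mono_degree k f \<in> I'" if "f \<in> I'" for f k
    using that unfolding I'_eq by (rule init_form_ideal_homogeneous[rotated]) (rule hom_I)
  have hom_C: "wpart mono_degree k f \<in> C" if f: "f \<in> C" for f k
  proof -
    obtain j where j: "var y ^ j * f \<in> I'"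
      using f unfolding C_eq_saturation by (auto simp: saturation_def)
    \<comment> \<open>Multiplication by \<open>var y ^ j\<close> shifts degrees by \<open>j\<close>,
      so components of \<open>f\<close> inherit membership in the saturation.\<close>
    have "wpart mono_degree (j + k) (var y ^ j * f) = var y ^ j * wpart mono_degree k f"
      by (simp add: var_power_eq wpart_single_mult[OF mono_degree_add] mono_degree_single)
    then have "var y ^ j * wpart mono_degree k f \<in> I'" using hom_I'[OF j, of "j + k"] by simp
    then show ?thesis unfolding C_eq_saturation by (auto simp: saturation_def)
  qed
  have hom_P: "wpart mono_degree k f \<in> P" if f: "f \<in> P" for f k
  proof -
    obtain a b where ab: "a \<in> P0" "f = a + var y * b" using f unfolding mem_P_iff by blast
    \<comment> \<open>The components of \<open>a\<close> are controlled through \<open>I'\<close>,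
      which contains \<open>P0\<close>, is homogeneous and lies in \<open>P\<close>.\<close>
    have "wpart mono_degree k a \<in> P" using ab(1) P0_subset_I' hom_I' I'_subset by blast
    moreover have "wpart mono_degree k (var y * b) \<in> P"
      using var_mult_mem_P ideal_zero[OF ideal_P]
      by (simp add: var_def wpart_single_mult[OF mono_degree_add])
    ultimately show ?thesis using ab(2) ideal_add[OF ideal_P] by (simp add: wpart_add)
  qed
  have rhs: "fps_nth (hilbert_series P + fps_X * hilbert_series C) k = int (card (?B k))" for k
    unfolding card_standard
    by (simp add: hilbert_series_nth[OF ideal_P hom_P] hilbert_series_nth[OF ideal_C hom_C])
  have lhs: "fps_nth (hilbert_series I) k = int (card (standard I k))" for k
    by (rule hilbert_series_nth[OF I hom_I])
  show "fps_nth (hilbert_series I) k \<ge> fps_nth (hilbert_series P + fps_X * hilbert_series C) k"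
    unfolding lhs rhs using card_mono[OF finite_standard standard_subset] by simp
  have "card (standard I k) = card (?B k) \<longleftrightarrow> standard I k \<subseteq> ?B k" for k
    using card_subset_eq[OF finite_standard standard_subset, of k] standard_subset[of k]
    by (metis subset_antisym subset_refl)
  then show "hilbert_series I = hilbert_series P + fps_X * hilbert_series C \<longleftrightarrow> I' = C \<inter> P"
    unfolding fps_eq_iff lhs rhs standard_eq_iff[symmetric] by simp
qed

end

theorem theorem2p1:
  fixes y :: "'v::finite"
    and prec :: "'v monomial \<Rightarrow> 'v monomial \<Rightarrow> bool"
    and I I' C P :: "('v, 'k::field) mpoly set"
    and m :: nat
    and d :: "nat \<Rightarrow> nat"
    and q r :: "nat \<Rightarrow> ('v, 'k) mpoly"
  assumes order: "term_order prec"
    and compat: "\<And>p :: ('v, 'k) mpoly. init_term prec p = init_term prec (init_form y p)"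
    and I: "ideal I poly_ring"
    and basis: "groebner_basis prec ((\<lambda>i. var y ^ d i * q i + r i) ` {1..m}) I"
    and form: "\<And>i. i \<in> {1..m} \<Longrightarrow> init_form y (var y ^ d i * q i + r i) = var y ^ d i * q i"
    and ndvd: "\<And>i. i \<in> {1..m} \<Longrightarrow> \<not> var y dvd q i"
  defines "I' \<equiv> Idl\<^bsub>poly_ring\<^esub> ((\<lambda>i. var y ^ d i * q i) ` {1..m})"
    and "C \<equiv> Idl\<^bsub>poly_ring\<^esub> (q ` {1..m})"
    and "P \<equiv> Idl\<^bsub>poly_ring\<^esub> (q ` {i \<in> {1..m}. d i = 0}) <+>\<^bsub>poly_ring\<^esub> Idl\<^bsub>poly_ring\<^esub> {var y}"
  shows
    "(groebner_basis prec ((\<lambda>i. var y ^ d i * q i) ` {1..m}) I' \<and>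
      groebner_basis prec (q ` {1..m}) C \<and>
      groebner_basis prec (q ` {i \<in> {1..m}. d i = 0} \<union> {var y}) P \<and>
      I' = init_form_ideal y I) \<and>
     (Max (d ` {1..m}) = 1 \<longrightarrow>
      I' = C \<inter> P \<and>
      init_ideal prec (C <+>\<^bsub>poly_ring\<^esub> P) = init_ideal prec C <+>\<^bsub>poly_ring\<^esub> init_ideal prec P) \<and>
     ideal_radical I' = ideal_radical C \<inter> ideal_radical P \<and>
     C = saturation I' (var y) \<and>
     (homogeneous_ideal I \<longrightarrow>
      (\<forall>k. fps_nth (hilbert_series I) k
           \<ge> fps_nth (hilbert_series P + fps_X * hilbert_series C) k) \<and>
      (hilbert_series I = hilbert_series P + fps_X * hilbert_series C \<longleftrightarrow> I' = C \<inter> P))"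
proof -
  interpret monomial_order prec by standard (rule order)
  have "lookup s y \<le> lookup t y" if st: "prec s t" for s t
  proof -
    \<comment> \<open>A test polynomial for the pair: its initial term sits at \<open>t\<close>, and
      \<open>compat\<close> forces \<open>t\<close> to survive in the initial y-form, so no monomial
      of \<open>?p\<close> has a larger exponent of \<open>y\<close>.\<close>
    let ?p = "single s 1 + single t 1 :: ('v, 'k) mpoly"
    have "s \<noteq> t" using st prec_irrefl by auto
    then have keys: "keys ?p = {s, t}"
      by (auto simp: in_keys_iff lookup_add lookup_single when_def split: if_splits)
    then have lm: "lm ?p = t" using st by (intro lm_eqI) auto
    have "lookup (init_term prec ?p) t \<noteq> 0"
      using keys lm by (auto simp: init_term_eq in_keys_iff)
    then have "lookup (init_term prec (init_form y ?p)) t \<noteq> 0"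
      unfolding compat[of ?p] .
    then have "t \<in> keys (init_form y ?p)"
      unfolding init_term_eq by (auto simp: in_keys_iff lookup_single when_def split: if_splits)
    then have "t \<in> {t \<in> keys ?p. \<forall>s\<in>keys ?p. lookup s y \<le> lookup t y}"
      unfolding init_form_def using keys_sum by (fastforce split: if_splits)
    then show ?thesis using keys by simp
  qed
  then interpret F: initial_y_forms prec y I "{1..m}" d q r
    by (intro initial_y_forms.intro initial_y_forms_axioms.intro y_order.intro y_order_axioms.intro
        monomial_order_axioms I basis form ndvd finite_atLeastAtMost)
  have eqs: "I' = F.I'" "C = F.C" "P = F.P"
    by (simp_all only: I'_def C_def P_def F.I'_def F.C_def F.P_def F.P0_def)
  \<comment> \<open>For \<open>m = 0\<close> the maximum is taken over the empty set, but then there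
    is no \<open>i\<close> to consider.\<close>
  have "d i \<le> 1" if "Max (d ` {1..m}) = 1" "i \<in> {1..m}" for i
    using that Max_ge[of "d ` {1..m}" "d i"] by simp
  then show ?thesis
    unfolding eqs
    using F.groebner_I' F.groebner_C F.groebner_P F.I'_eq F.I'_eq_Int F.init_ideal_C_plus_P
      F.radical_I' F.C_eq_saturation F.hilbert_series_bound
    by blast
qed

end
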